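(* Let $R=k[x_1,\dots,x_n]$ where $k$ is a field of characteristic zero. Then for every integer $\mu\in\left[n,\binom{n+1}{2}\right]$ there is an artinian ideal $I\subseteq R$ (i.e. $R/I$ is artinian) minimally generated by $\mu$ quadratic monomials such that $R/I$ has the strong Lefschetz property.
   Context: A standard graded artinian $k$-algebra $A$ has the strong Lefschetz property (SLP) if there is a linear form $\ell\in A_1$ such that for all integers $s,d\ge 0$ the multiplication map $\cdot\ell^s:A_d\to A_{d+s}$ has full rank (i.e. is injective or surjective). A quadratic monomial is a monomial of degree 2. *)

theory Defs
  imports "HOL-Algebra.QuotRing" "HOL-Library.Poly_Mapping"
begin

(* A monomial x_0^{a_0} x_1^{a_1} ... is its finitely supported exponent vector a :: nat \<Rightarrow>\<^sub>0 nat,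
   and a polynomial is a finitely supported function from monomials to coefficients, so that
   the product of HOL-Library.Poly_Mapping is the usual (convolution) product. *)

(* The polynomial ring k[x_0, ..., x_{n-1}], with k the type 'k. *)
definition mpoly_ring :: "nat \<Rightarrow> ((nat \<Rightarrow>\<^sub>0 nat) \<Rightarrow>\<^sub>0 'k::field) ring" where
  "mpoly_ring n =
     \<lparr>carrier = {p. \<forall>m\<in>Poly_Mapping.keys p. Poly_Mapping.keys m \<subseteq> {..<n}},
      mult = (*), one = 1, zero = 0, add = (+)\<rparr>"

definition mon_degree :: "(nat \<Rightarrow>\<^sub>0 nat) \<Rightarrow> nat" where
  "mon_degree m = (\<Sum>i\<in>Poly_Mapping.keys m. Poly_Mapping.lookup m i)"

(* The degree d part of k[x_0, ..., x_{n-1}]; it contains 0. *)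
definition homogeneous_part :: "nat \<Rightarrow> nat \<Rightarrow> ((nat \<Rightarrow>\<^sub>0 nat) \<Rightarrow>\<^sub>0 'k::field) set" where
  "homogeneous_part n d = {p \<in> carrier (mpoly_ring n). \<forall>m\<in>Poly_Mapping.keys p. mon_degree m = d}"

definition quadratic_monomials :: "nat \<Rightarrow> ((nat \<Rightarrow>\<^sub>0 nat) \<Rightarrow>\<^sub>0 'k::field) set" where
  "quadratic_monomials n =
     {Poly_Mapping.single m 1 | m. Poly_Mapping.keys m \<subseteq> {..<n} \<and> mon_degree m = 2}"

(* The degree d part of R/I, where R = k[x_0, ..., x_{n-1}]: the image of R_d. The family is a grading
   of R/I when I is a homogeneous ideal, in particular when I is generated by monomials. *)
definition quotient_part ::
  "nat \<Rightarrow> ((nat \<Rightarrow>\<^sub>0 nat) \<Rightarrow>\<^sub>0 'k::field) set \<Rightarrow> nat \<Rightarrow> ((nat \<Rightarrow>\<^sub>0 nat) \<Rightarrow>\<^sub>0 'k) set set" where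
  "quotient_part n I d = (\<lambda>p. I +>\<^bsub>mpoly_ring n\<^esub> p) ` homogeneous_part n d"

locale artinian_cring = cring +
  assumes descending_chain:
    "\<lbrakk>\<And>i::nat. ideal (J i) R; \<And>i. J (Suc i) \<subseteq> J i\<rbrakk> \<Longrightarrow> \<exists>m. \<forall>i\<ge>m. J i = J m"

definition minimally_generates :: "('a, 'b) ring_scheme \<Rightarrow> 'a set \<Rightarrow> 'a set \<Rightarrow> bool" where
  "minimally_generates R G I \<longleftrightarrow>
     G \<subseteq> carrier R \<and> Idl\<^bsub>R\<^esub> G = I \<and> (\<forall>H. H \<subset> G \<longrightarrow> Idl\<^bsub>R\<^esub> H \<noteq> I)"

(* gr d is the degree d part of the graded algebra A. *)
definition strong_lefschetz :: "('a, 'b) ring_scheme \<Rightarrow> (nat \<Rightarrow> 'a set) \<Rightarrow> bool" where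
  "strong_lefschetz A gr \<longleftrightarrow>
     (\<exists>l\<in>gr 1. \<forall>s d.
        inj_on (\<lambda>a. (l [^]\<^bsub>A\<^esub> (s::nat)) \<otimes>\<^bsub>A\<^esub> a) (gr d) \<or>
        (\<lambda>a. (l [^]\<^bsub>A\<^esub> s) \<otimes>\<^bsub>A\<^esub> a) ` gr d = gr (d + s))"

lemma mpoly_ring_cring: "cring (mpoly_ring n :: ((nat \<Rightarrow>\<^sub>0 nat) \<Rightarrow>\<^sub>0 'k::field) ring)"
proof -
  define C where
    "C = {p :: (nat \<Rightarrow>\<^sub>0 nat) \<Rightarrow>\<^sub>0 'k. \<forall>m\<in>Poly_Mapping.keys p. Poly_Mapping.keys m \<subseteq> {..<n}}"
  have R: "mpoly_ring n = \<lparr>carrier = C, mult = (*), one = 1, zero = 0, add = (+)\<rparr>"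
    by (simp add: mpoly_ring_def C_def)
  have zero: "0 \<in> C" and one: "1 \<in> C"
    by (simp_all add: C_def)
  have add: "p + q \<in> C" if "p \<in> C" "q \<in> C" for p q
    using that Poly_Mapping.keys_add[of p q] unfolding C_def by blast
  have mult: "p * q \<in> C" if "p \<in> C" "q \<in> C" for p q
    unfolding C_def
  proof (intro CollectI ballI)
    fix m assume "m \<in> Poly_Mapping.keys (p * q)"
    then obtain a b where m: "m = a + b" and ab: "a \<in> Poly_Mapping.keys p" "b \<in> Poly_Mapping.keys q"
      using keys_mult[of p q] by blast
    have "Poly_Mapping.keys a \<subseteq> {..<n}" "Poly_Mapping.keys b \<subseteq> {..<n}"
      using ab that by (auto simp: C_def)
    then show "Poly_Mapping.keys m \<subseteq> {..<n}"
      using Poly_Mapping.keys_add[of a b] unfolding m by blast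
  qed
  have minus: "- p \<in> C" if "p \<in> C" for p
    using that by (simp add: C_def)
  show ?thesis
    unfolding R
  proof (rule cringI)
    show "abelian_group \<lparr>carrier = C, mult = (*), one = 1, zero = 0, add = (+)\<rparr>"
      by (rule abelian_groupI)
        (auto simp: add zero add.assoc add.commute intro: bexI[of _ "- p" for p] minus)
    show "comm_monoid \<lparr>carrier = C, mult = (*), one = 1, zero = 0, add = (+)\<rparr>"
      by (rule comm_monoidI) (simp_all add: mult one mult.assoc mult.commute)
  qed (simp add: distrib_right)
qed

end

theory Submission
  imports Defs
begin

text \<open>
  Call a graded algebra with a linear form \<open>l\<close> centred at \<open>c\<close> if it vanishes above degree \<open>c\<close> and
  \<open>l ^ s\<close> is injective on degree \<open>d\<close> when \<open>2 * d + s \<le> c\<close> and surjective onto degree \<open>d + s\<close>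
  otherwise; in terms of Jordan strings of \<open>l\<close>, a string from degree \<open>a\<close> to degree \<open>b\<close> has
  \<open>a + b\<close> equal to \<open>c\<close> or \<open>c + 1\<close>. Unlike the strong Lefschetz property alone, this is inherited by
  \<open>A[x]/(x\<^sup>2)\<close>, with \<open>l + x\<close> and \<open>c + 1\<close>, because
  \<open>(l + x) ^ s = l ^ s + s * x * l ^ (s - 1)\<close> there. Passing from \<open>A\<close> to \<open>A[x]/(x\<^sup>2)\<close> adds one
  variable and one generator. So by induction on \<open>n\<close> only the values of \<open>\<mu>\<close> less than \<open>n\<close> below the
  maximum remain, and for these one kills all quadratic monomials except
  \<open>x\<^sub>0 * x\<^sub>1, \<dots>, x\<^sub>0 * x\<^sub>r\<close>; that quotient lives in degrees at most 2 and is centred by inspection.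
\<close>

section \<open>Exponent vectors, degrees and coefficients\<close>

lemma mon_degree_add: "mon_degree (a + b) = mon_degree a + mon_degree b"
proof -
  define K where "K = Poly_Mapping.keys a \<union> Poly_Mapping.keys b"
  have sub: "mon_degree m = (\<Sum>i\<in>K. Poly_Mapping.lookup m i)" if "Poly_Mapping.keys m \<subseteq> K" for m
    unfolding mon_degree_def using that
    by (intro sum.mono_neutral_left) (auto simp: K_def in_keys_iff)
  show ?thesis
    using Poly_Mapping.keys_add[of a b]
    by (simp add: sub K_def lookup_add sum.distrib)
qed

lemma mon_degree_zero [simp]: "mon_degree 0 = 0"
  by (simp add: mon_degree_def)

lemma mon_degree_single [simp]: "mon_degree (Poly_Mapping.single i k) = k"
  by (simp add: mon_degree_def)

lemma mon_degree_eq_0_iff [simp]: "mon_degree m = 0 \<longleftrightarrow> m = 0"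
  by (auto simp: mon_degree_def in_keys_iff intro!: poly_mapping_eqI)

text \<open>Subtraction of exponent vectors is truncated, so the coordinatewise bound, which says
  that \<open>a\<close> divides \<open>m\<close>, is what makes the quotient exact.\<close>

lemma mon_add_diff:
  fixes a m :: "nat \<Rightarrow>\<^sub>0 nat"
  assumes "\<And>i. Poly_Mapping.lookup a i \<le> Poly_Mapping.lookup m i"
  shows "m = a + (m - a)"
  by (rule poly_mapping_eqI) (simp add: lookup_add lookup_minus assms)

lemma mon_split_var:
  fixes m :: "nat \<Rightarrow>\<^sub>0 nat"
  assumes "k \<le> Poly_Mapping.lookup m i"
  shows "m = Poly_Mapping.single i k + (m - Poly_Mapping.single i k)"
  by (rule mon_add_diff) (auto simp: lookup_single when_def assms)

text \<open>Natural exponents cannot cancel, so the usual inclusion of supports becomes an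
  equality.\<close>

lemma keys_add_mon:
  "Poly_Mapping.keys (a + b :: nat \<Rightarrow>\<^sub>0 nat) = Poly_Mapping.keys a \<union> Poly_Mapping.keys b"
  by (auto simp: in_keys_iff lookup_add)

text \<open>A polynomial is the sum of its terms. Confining the terms to \<open>M\<close> lets one
  rule serve both homogeneous polynomials and members of monomial ideals.\<close>

lemma poly_induct [consumes 1, case_names zero add single]:
  fixes p :: "'a \<Rightarrow>\<^sub>0 'b::comm_monoid_add"
  assumes "Poly_Mapping.keys p \<subseteq> M"
    and "P 0" "\<And>p q. P p \<Longrightarrow> P q \<Longrightarrow> P (p + q)"
    and "\<And>m c. m \<in> M \<Longrightarrow> P (Poly_Mapping.single m c)"
  shows "P p"
proof -
  have "P (\<Sum>m\<in>F. Poly_Mapping.single m (Poly_Mapping.lookup p m))"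
    if "finite F" "F \<subseteq> M" for F
    using that by (induction F rule: finite_induct) (auto intro: assms)
  moreover have "(\<Sum>m\<in>Poly_Mapping.keys p. Poly_Mapping.single m (Poly_Mapping.lookup p m)) = p"
  proof (rule poly_mapping_eqI)
    fix k
    have "Poly_Mapping.lookup (\<Sum>m\<in>Poly_Mapping.keys p. Poly_Mapping.single m (Poly_Mapping.lookup p m)) k
      = (\<Sum>m\<in>Poly_Mapping.keys p. if m = k then Poly_Mapping.lookup p m else 0)"
      by (simp add: lookup_sum lookup_single when_def)
    also have "\<dots> = Poly_Mapping.lookup p k"
      by (simp add: in_keys_iff)
    finally show "Poly_Mapping.lookup (\<Sum>m\<in>Poly_Mapping.keys p.
        Poly_Mapping.single m (Poly_Mapping.lookup p m)) k = Poly_Mapping.lookup p k" .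
  qed
  ultimately show ?thesis
    using assms(1) by (metis finite_keys)
qed

lemma lookup_single_mult:
  fixes v :: "(nat \<Rightarrow>\<^sub>0 nat) \<Rightarrow>\<^sub>0 'k::comm_ring_1"
  shows "Poly_Mapping.lookup (Poly_Mapping.single a c * v) (a + m) = c * Poly_Mapping.lookup v m"
  by (simp add: lookup_mult lookup_single when_mult)

lemma lookup_single_mult_eq_0:
  fixes v :: "(nat \<Rightarrow>\<^sub>0 nat) \<Rightarrow>\<^sub>0 'k::comm_ring_1"
  assumes "\<And>b. m \<noteq> a + b"
  shows "Poly_Mapping.lookup (Poly_Mapping.single a c * v) m = 0"
proof -
  have "m \<notin> Poly_Mapping.keys (Poly_Mapping.single a c * v)"
    using keys_mult[of "Poly_Mapping.single a c" v] assms by (auto split: if_splits)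
  then show ?thesis
    by (simp add: in_keys_iff)
qed

lemma lookup_of_nat_mult:
  fixes v :: "(nat \<Rightarrow>\<^sub>0 nat) \<Rightarrow>\<^sub>0 'k::comm_ring_1"
  shows "Poly_Mapping.lookup (of_nat k * v) m = of_nat k * Poly_Mapping.lookup v m"
  by (induction k) (simp_all add: distrib_right lookup_add)

section \<open>Homogeneous polynomials\<close>

lemma carrier_mpoly_ring:
  "p \<in> carrier (mpoly_ring n) \<longleftrightarrow> (\<forall>m\<in>Poly_Mapping.keys p. Poly_Mapping.keys m \<subseteq> {..<n})"
  by (simp add: mpoly_ring_def)

lemma mpoly_ring_simps [simp]:
  "a \<otimes>\<^bsub>mpoly_ring n\<^esub> b = a * b" "a \<oplus>\<^bsub>mpoly_ring n\<^esub> b = a + b"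
  "\<one>\<^bsub>mpoly_ring n\<^esub> = 1" "\<zero>\<^bsub>mpoly_ring n\<^esub> = 0"
  by (simp_all add: mpoly_ring_def)

lemma homogeneous_part_iff:
  "p \<in> homogeneous_part n d \<longleftrightarrow>
     (\<forall>m\<in>Poly_Mapping.keys p. Poly_Mapping.keys m \<subseteq> {..<n} \<and> mon_degree m = d)"
  by (auto simp: homogeneous_part_def carrier_mpoly_ring)

lemma homogeneous_part_induct [consumes 1, case_names zero add single]:
  assumes "p \<in> homogeneous_part n d"
    and "P 0" "\<And>p q. P p \<Longrightarrow> P q \<Longrightarrow> P (p + q)"
    and "\<And>m c. Poly_Mapping.keys m \<subseteq> {..<n} \<Longrightarrow> mon_degree m = d \<Longrightarrow> P (Poly_Mapping.single m c)"
  shows "P p"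
  by (rule poly_induct[where M = "{m. Poly_Mapping.keys m \<subseteq> {..<n} \<and> mon_degree m = d}"])
    (use assms in \<open>auto simp: homogeneous_part_iff\<close>)

lemma homogeneous_part_carrier: "p \<in> homogeneous_part n d \<Longrightarrow> p \<in> carrier (mpoly_ring n)"
  by (simp add: homogeneous_part_def)

lemma zero_homogeneous_part [simp]: "0 \<in> homogeneous_part n d"
  by (simp add: homogeneous_part_iff)

lemma one_homogeneous_part [simp]: "1 \<in> homogeneous_part n 0"
  by (simp add: homogeneous_part_iff)

lemma single_homogeneous_part:
  "Poly_Mapping.keys m \<subseteq> {..<n} \<Longrightarrow> mon_degree m = d \<Longrightarrow> Poly_Mapping.single m c \<in> homogeneous_part n d"
  by (simp add: homogeneous_part_iff)

lemma homogeneous_part_add: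
  "p \<in> homogeneous_part n d \<Longrightarrow> q \<in> homogeneous_part n d \<Longrightarrow> p + q \<in> homogeneous_part n d"
  using Poly_Mapping.keys_add[of p q] unfolding homogeneous_part_iff by blast

lemma homogeneous_part_diff:
  "p \<in> homogeneous_part n d \<Longrightarrow> q \<in> homogeneous_part n d \<Longrightarrow> p - q \<in> homogeneous_part n d"
  using homogeneous_part_add[of p n d "- q"] by (simp add: homogeneous_part_iff)

lemma homogeneous_part_mult:
  assumes "p \<in> homogeneous_part n d" "q \<in> homogeneous_part n e"
  shows "p * q \<in> homogeneous_part n (d + e)"
  unfolding homogeneous_part_iff
proof
  fix m assume "m \<in> Poly_Mapping.keys (p * q)"
  then obtain a b where "m = a + b" "a \<in> Poly_Mapping.keys p" "b \<in> Poly_Mapping.keys q"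
    using keys_mult[of p q] by blast
  then show "Poly_Mapping.keys m \<subseteq> {..<n} \<and> mon_degree m = d + e"
    using assms by (auto simp: homogeneous_part_iff keys_add_mon mon_degree_add)
qed

lemma homogeneous_part_power:
  "l \<in> homogeneous_part n 1 \<Longrightarrow> l ^ s \<in> homogeneous_part n s"
  by (induction s) (use homogeneous_part_mult[of l n 1 "l ^ s" for s] in auto)

lemma homogeneous_part_of_nat: "of_nat k \<in> homogeneous_part n 0"
  by (induction k) (auto intro: homogeneous_part_add)

lemma homogeneous_part_mono: "n \<le> n' \<Longrightarrow> p \<in> homogeneous_part n d \<Longrightarrow> p \<in> homogeneous_part n' d"
  unfolding homogeneous_part_iff by (meson lessThan_subset_iff order_trans)

section \<open>Vanishing modulo a monomial ideal, and standard monomials\<close>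

text \<open>A polynomial lies in \<open>null_on S\<close> iff it vanishes in the monomial quotient whose basis is \<open>S\<close>.\<close>

definition null_on :: "'a set \<Rightarrow> ('a \<Rightarrow>\<^sub>0 'b::zero) set" where
  "null_on S = {p. \<forall>m\<in>S. Poly_Mapping.lookup p m = 0}"

lemma null_on_zero [simp]: "0 \<in> null_on S"
  by (simp add: null_on_def)

lemma null_on_add: "p \<in> null_on S \<Longrightarrow> q \<in> null_on S \<Longrightarrow> p + q \<in> null_on S"
  for p :: "'a \<Rightarrow>\<^sub>0 'b::monoid_add"
  by (simp add: null_on_def lookup_add)

lemma null_on_diff: "p \<in> null_on S \<Longrightarrow> q \<in> null_on S \<Longrightarrow> p - q \<in> null_on S"
  for p :: "'a \<Rightarrow>\<^sub>0 'b::ab_group_add"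
  by (simp add: null_on_def lookup_minus)

lemma null_on_add_iff: "q \<in> null_on S \<Longrightarrow> p + q \<in> null_on S \<longleftrightarrow> p \<in> null_on S"
  for p :: "'a \<Rightarrow>\<^sub>0 'b::ab_group_add"
  using null_on_add[of p S q] null_on_diff[of "p + q" S q] by auto

lemma null_on_of_nat_mult_iff:
  fixes p :: "(nat \<Rightarrow>\<^sub>0 nat) \<Rightarrow>\<^sub>0 'k::field_char_0"
  shows "k \<noteq> 0 \<Longrightarrow> of_nat k * p \<in> null_on S \<longleftrightarrow> p \<in> null_on S"
  by (simp add: null_on_def lookup_of_nat_mult)

text \<open>Order ideals for divisibility: their complements are closed under multiplication by
  monomials.\<close>

definition down_closed :: "(nat \<Rightarrow>\<^sub>0 nat) set \<Rightarrow> bool" where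
  "down_closed S \<longleftrightarrow> (\<forall>a b. a + b \<in> S \<longrightarrow> b \<in> S)"

text \<open>A monomial of \<open>f * p\<close> is a multiple of some monomial of \<open>p\<close>;
  if it lay in \<open>S\<close>, so would that divisor, where \<open>p\<close> has coefficient
  0.\<close>

lemma null_on_mult:
  fixes p :: "(nat \<Rightarrow>\<^sub>0 nat) \<Rightarrow>\<^sub>0 'k::comm_ring_1"
  assumes "down_closed S" "p \<in> null_on S"
  shows "f * p \<in> null_on S"
proof -
  have "m \<notin> Poly_Mapping.keys (f * p)" if "m \<in> S" for m
  proof
    assume "m \<in> Poly_Mapping.keys (f * p)"
    then obtain a b where "m = a + b" "b \<in> Poly_Mapping.keys p"
      using keys_mult[of f p] by blast
    then show False
      using assms that by (auto simp: down_closed_def null_on_def in_keys_iff)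
  qed
  then show ?thesis
    by (auto simp: null_on_def in_keys_iff)
qed

text \<open>The standard monomials of the ideal generated by \<open>Q\<close>; their classes form a
  basis of the quotient.\<close>

definition standard :: "nat \<Rightarrow> (nat \<Rightarrow>\<^sub>0 nat) set \<Rightarrow> (nat \<Rightarrow>\<^sub>0 nat) set" where
  "standard n Q = {m. Poly_Mapping.keys m \<subseteq> {..<n} \<and> (\<forall>q\<in>Q. \<forall>a. m \<noteq> q + a)}"

lemma standard_down_closed: "down_closed (standard n Q)"
  by (auto simp: down_closed_def standard_def keys_add_mon)
    (metis add.left_commute)

lemma null_on_standard_mult:
  fixes p :: "(nat \<Rightarrow>\<^sub>0 nat) \<Rightarrow>\<^sub>0 'k::comm_ring_1"
  shows "p \<in> null_on (standard n Q) \<Longrightarrow> f * p \<in> null_on (standard n Q)"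
  by (rule null_on_mult[OF standard_down_closed])

text \<open>Describes the basis of \<open>A[x]/(x^2)\<close>: the new square bounds the exponent of
  variable \<open>n\<close> by 1, and the members of \<open>Q\<close> do not see that
  variable.\<close>

lemma standard_Suc:
  assumes Q: "\<And>q. q \<in> Q \<Longrightarrow> Poly_Mapping.keys q \<subseteq> {..<n}"
  shows "standard (Suc n) (insert (Poly_Mapping.single n 2) Q) =
    standard n Q \<union> (+) (Poly_Mapping.single n 1) ` standard n Q" (is "?L = ?R")
proof (intro equalityI subsetI)
  fix m assume m: "m \<in> ?L"
  then have keys: "Poly_Mapping.keys m \<subseteq> {..<Suc n}" and nQ: "\<And>q a. q \<in> Q \<Longrightarrow> m \<noteq> q + a"
    and n2: "\<And>a. m \<noteq> Poly_Mapping.single n 2 + a"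
    by (auto simp: standard_def)
  have "\<not> 2 \<le> Poly_Mapping.lookup m n"
    using n2 mon_split_var by blast
  then consider "Poly_Mapping.lookup m n = 0" | "Poly_Mapping.lookup m n = 1"
    by linarith
  then show "m \<in> ?R"
  proof cases
    case 1
    then have "Poly_Mapping.keys m \<subseteq> {..<n}"
      using keys not_in_keys_iff_lookup_eq_zero[of n m] by (auto simp: lessThan_Suc)
    then show ?thesis
      using nQ by (auto simp: standard_def)
  next
    case 2
    define m' where "m' = m - Poly_Mapping.single n 1"
    have m': "m = Poly_Mapping.single n 1 + m'"
      unfolding m'_def by (rule mon_split_var) (simp add: 2)
    have "n \<notin> Poly_Mapping.keys m'"
      using 2 unfolding m'_def by (simp add: in_keys_iff lookup_minus)
    then have "Poly_Mapping.keys m' \<subseteq> {..<n}"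
      using keys unfolding m' by (auto simp: keys_add_mon lessThan_Suc)
    moreover have "m' \<noteq> q + a" if "q \<in> Q" for q a
      using nQ[OF that, of "Poly_Mapping.single n 1 + a"] m' by (metis add.left_commute)
    ultimately show ?thesis
      using m' by (auto simp: standard_def)
  qed
next
  fix m assume "m \<in> ?R"
  \<comment> \<open>Both halves of the union are treated at once, \<open>k\<close> being the
    exponent of variable \<open>n\<close>.\<close>
  then obtain m' k where m': "m' \<in> standard n Q" and k: "k \<le> 1" and m: "m = Poly_Mapping.single n k + m'"
    by (metis (no_types, lifting) UnE add_0 image_iff order_refl single_zero zero_le)
  have n0: "Poly_Mapping.lookup p n = 0" if "Poly_Mapping.keys p \<subseteq> {..<n}" for p :: "nat \<Rightarrow>\<^sub>0 nat"
    using that by (auto simp: in_keys_iff)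
  have keys: "Poly_Mapping.keys m' \<subseteq> {..<n}"
    using m' by (simp add: standard_def)
  have ln: "Poly_Mapping.lookup m n = k"
    by (simp add: m lookup_add n0[OF keys])
  have "m \<noteq> Poly_Mapping.single n 2 + a" for a
    using ln k by (auto simp: lookup_add)
  moreover have "m \<noteq> q + a" if "q \<in> Q" for q a
  proof
    assume ma: "m = q + a"
    then have "Poly_Mapping.lookup a n = k"
      using ln n0[OF Q[OF that]] by (simp add: lookup_add)
    \<comment> \<open>As \<open>q\<close> is free of variable \<open>n\<close>, its whole power sits
      in \<open>a\<close>; cancelling it would make \<open>m'\<close> a multiple of
      \<open>q\<close>.\<close>
    then have "a = Poly_Mapping.single n k + (a - Poly_Mapping.single n k)"
      by (intro mon_split_var) simp
    then have "Poly_Mapping.single n k + m' = Poly_Mapping.single n k + (q + (a - Poly_Mapping.single n k))"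
      using ma m by (metis add.left_commute)
    then show False
      using m' that by (auto simp: standard_def)
  qed
  moreover have "Poly_Mapping.keys m \<subseteq> {..<Suc n}"
    using keys unfolding m by (auto simp: keys_add_mon split: if_splits)
  ultimately show "m \<in> ?L"
    by (auto simp: standard_def)
qed

section \<open>Adjoining a variable of square zero\<close>

text \<open>Neither \<open>u\<close> nor \<open>v\<close> involves variable \<open>n\<close>, so the
  coefficients on \<open>S\<close> come from \<open>u\<close> alone and those on the shifted copy
  from \<open>v\<close> alone.\<close>

lemma null_on_cone_iff:
  fixes u v :: "(nat \<Rightarrow>\<^sub>0 nat) \<Rightarrow>\<^sub>0 'k::field"
  assumes S: "\<And>m. m \<in> S \<Longrightarrow> Poly_Mapping.keys m \<subseteq> {..<n}"
    and u: "u \<in> carrier (mpoly_ring n)" and v: "v \<in> carrier (mpoly_ring n)"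
  defines "e \<equiv> Poly_Mapping.single n (1::nat)"
  shows "u + Poly_Mapping.single e 1 * v \<in> null_on (S \<union> (+) e ` S) \<longleftrightarrow>
    u \<in> null_on S \<and> v \<in> null_on S"
proof -
  have "Poly_Mapping.lookup (Poly_Mapping.single e 1 * v) m = 0" if "m \<in> S" for m
    by (rule lookup_single_mult_eq_0) (use S[OF that] in \<open>auto simp: e_def keys_add_mon\<close>)
  moreover have "Poly_Mapping.lookup u (e + m) = 0" for m
    using u by (auto simp: carrier_mpoly_ring e_def keys_add_mon simp flip: not_in_keys_iff_lookup_eq_zero)
  ultimately show ?thesis
    by (auto simp: null_on_def lookup_add lookup_single_mult ball_Un)
qed

text \<open>Injectivity and surjectivity are phrased for polynomial representatives modulo
  \<open>null_on S\<close>, so that cosets enter only when the result is transferred to the quotient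
  ring.\<close>

definition centred ::
  "nat \<Rightarrow> (nat \<Rightarrow>\<^sub>0 nat) set \<Rightarrow> ((nat \<Rightarrow>\<^sub>0 nat) \<Rightarrow>\<^sub>0 'k::field) \<Rightarrow> nat \<Rightarrow> bool" where
  "centred n S l c \<longleftrightarrow> l \<in> homogeneous_part n 1 \<and> (\<forall>m\<in>S. mon_degree m \<le> c) \<and>
     (\<forall>d s. 2 * d + s \<le> c \<longrightarrow>
        (\<forall>p\<in>homogeneous_part n d. l ^ s * p \<in> null_on S \<longrightarrow> p \<in> null_on S)) \<and>
     (\<forall>d s. c < 2 * d + s \<longrightarrow>
        (\<forall>q\<in>homogeneous_part n (d + s). \<exists>p\<in>homogeneous_part n d. l ^ s * p - q \<in> null_on S))"

text \<open>Monomials are sorted by their exponent of variable \<open>n\<close>: 0 goes to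
  \<open>u\<close>, 1 goes to \<open>v\<close>, and anything higher vanishes on the basis. The
  clause for \<open>d = 0\<close> is there because \<open>d - 1\<close> is then truncated to 0 and
  says nothing useful about \<open>v\<close>.\<close>

lemma cone_decomposition:
  fixes p :: "(nat \<Rightarrow>\<^sub>0 nat) \<Rightarrow>\<^sub>0 'k::field"
  assumes p: "p \<in> homogeneous_part (Suc n) d"
    and S: "\<And>m. m \<in> S \<Longrightarrow> Poly_Mapping.keys m \<subseteq> {..<n}"
  defines "e \<equiv> Poly_Mapping.single n (1::nat)"
  shows "\<exists>u\<in>homogeneous_part n d. \<exists>v\<in>homogeneous_part n (d - 1). (d = 0 \<longrightarrow> v = 0) \<and>
    p - (u + Poly_Mapping.single e 1 * v) \<in> null_on (S \<union> (+) e ` S)"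
  using p
proof (induction rule: homogeneous_part_induct)
  case zero
  show ?case
    by (intro bexI[of _ 0]) auto
next
  case (add p q)
  then obtain u v u' v' where *:
    "u \<in> homogeneous_part n d" "v \<in> homogeneous_part n (d - 1)" "d = 0 \<longrightarrow> v = 0"
    "p - (u + Poly_Mapping.single e 1 * v) \<in> null_on (S \<union> (+) e ` S)"
    "u' \<in> homogeneous_part n d" "v' \<in> homogeneous_part n (d - 1)" "d = 0 \<longrightarrow> v' = 0"
    "q - (u' + Poly_Mapping.single e 1 * v') \<in> null_on (S \<union> (+) e ` S)"
    by blast
  have "p + q - (u + u' + Poly_Mapping.single e 1 * (v + v')) =
    p - (u + Poly_Mapping.single e 1 * v) + (q - (u' + Poly_Mapping.single e 1 * v'))"
    by (simp add: algebra_simps)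
  then have "p + q - (u + u' + Poly_Mapping.single e 1 * (v + v')) \<in> null_on (S \<union> (+) e ` S)"
    using null_on_add[OF *(4,8)] by (simp only:)
  then show ?case
    using homogeneous_part_add *(1-3,5-7) by (metis add_0)
next
  case (single m c)
  have keys_le: "Poly_Mapping.keys m' \<subseteq> {..<n}" if "Poly_Mapping.keys m' \<subseteq> {..<Suc n}"
    "Poly_Mapping.lookup m' n = 0" for m' :: "nat \<Rightarrow>\<^sub>0 nat"
    using that not_in_keys_iff_lookup_eq_zero[of n m'] by (auto simp: lessThan_Suc)
  consider "Poly_Mapping.lookup m n = 0" | "Poly_Mapping.lookup m n = 1" | "2 \<le> Poly_Mapping.lookup m n"
    by linarith
  then show ?case
  proof cases
    case 1
    then show ?thesis
      using single keys_le
      by (intro bexI[of _ "Poly_Mapping.single m c"] bexI[of _ 0]) (auto intro!: single_homogeneous_part)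
  next
    case 2
    define m' where "m' = m - e"
    have m: "m = e + m'"
      unfolding m'_def e_def by (rule mon_split_var) (simp add: 2)
    have "Poly_Mapping.keys m' \<subseteq> {..<Suc n}"
      using single(1) unfolding m keys_add_mon by simp
    then have "Poly_Mapping.keys m' \<subseteq> {..<n}"
      by (rule keys_le) (simp add: m'_def e_def lookup_minus 2)
    moreover have "d = Suc (mon_degree m')"
      using single(2) by (simp add: m mon_degree_add e_def)
    ultimately show ?thesis
      by (intro bexI[of _ 0] bexI[of _ "Poly_Mapping.single m' c"])
        (auto simp: m mult_single intro!: single_homogeneous_part)
  next
    case 3
    have "Poly_Mapping.lookup m' n \<le> 1" if "m' \<in> S \<union> (+) e ` S" for m'
      using that S by (auto simp: e_def lookup_add in_keys_iff subset_iff)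
        (metis gr_zeroI less_irrefl zero_le)+
    from this[of m] have "m \<notin> S \<union> (+) e ` S"
      using 3 by (metis Suc_1 not_less_eq_eq)
    then show ?thesis
      by (intro bexI[of _ 0]) (auto simp: null_on_def lookup_single when_def)
  qed
qed

text \<open>The binomial expansion cut off after the linear term in \<open>x\<close>.\<close>

lemma power_Suc_add_mod_square:
  fixes l x :: "'a::comm_ring_1"
  shows "\<exists>g. (l + x) ^ Suc s = l ^ Suc s + of_nat (Suc s) * x * l ^ s + x ^ 2 * g"
proof (induction s)
  case 0
  show ?case by (rule exI[of _ 0]) simp
next
  case (Suc s)
  then obtain g where g: "(l + x) ^ Suc s = l ^ Suc s + of_nat (Suc s) * x * l ^ s + x ^ 2 * g" ..
  have "(l + x) ^ Suc (Suc s) = (l + x) * (l ^ Suc s + of_nat (Suc s) * x * l ^ s + x ^ 2 * g)"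
    by (simp only: power_Suc[of _ "Suc s"] g)
  also have "\<dots> = l ^ Suc (Suc s) + of_nat (Suc (Suc s)) * x * l ^ Suc s +
      x ^ 2 * (of_nat (Suc s) * l ^ s + (l + x) * g)"
    by (simp add: algebra_simps power2_eq_square)
  finally show ?case by blast
qed

text \<open>Modulo \<open>x ^ 2\<close>, the power \<open>(l + x) ^ s\<close> sends
  \<open>u + x * v\<close> to the pair \<open>l ^ s * u\<close> and
  \<open>l ^ s * v + s * l ^ (s - 1) * u\<close>. The hypothesis is used for \<open>u\<close> with
  degree \<open>d\<close> and exponent \<open>s - 1\<close>, and for \<open>v\<close> with degree
  \<open>d - 1\<close> and exponent \<open>s + 1\<close>. Both give \<open>2 * d + s - 1\<close> for
  comparison with \<open>c\<close>, which is why the centre moves by exactly one.\<close>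

lemma centred_cone:
  fixes l :: "(nat \<Rightarrow>\<^sub>0 nat) \<Rightarrow>\<^sub>0 'k::field_char_0"
  assumes Q: "\<And>q. q \<in> Q \<Longrightarrow> Poly_Mapping.keys q \<subseteq> {..<n}"
    and C: "centred n (standard n Q) l c"
  shows "centred (Suc n) (standard (Suc n) (insert (Poly_Mapping.single n 2) Q))
    (l + Poly_Mapping.single (Poly_Mapping.single n 1) 1) (Suc c)"
proof -
  define S where "S = standard n Q"
  define T where "T = standard (Suc n) (insert (Poly_Mapping.single n 2) Q)"
  define e where "e = Poly_Mapping.single n (1::nat)"
  define x :: "(nat \<Rightarrow>\<^sub>0 nat) \<Rightarrow>\<^sub>0 'k" where "x = Poly_Mapping.single e 1"
  have TS: "T = S \<union> (+) e ` S"
    unfolding T_def S_def e_def by (rule standard_Suc[OF Q])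
  have Skeys: "Poly_Mapping.keys m \<subseteq> {..<n}" if "m \<in> S" for m
    using that by (simp add: S_def standard_def)
  have l: "l \<in> homogeneous_part n 1" and deg: "\<And>m. m \<in> S \<Longrightarrow> mon_degree m \<le> c"
    and inj: "\<And>d s p. 2 * d + s \<le> c \<Longrightarrow> p \<in> homogeneous_part n d \<Longrightarrow> l ^ s * p \<in> null_on S \<Longrightarrow> p \<in> null_on S"
    and surj: "\<And>d s q. c < 2 * d + s \<Longrightarrow> q \<in> homogeneous_part n (d + s) \<Longrightarrow>
      \<exists>p\<in>homogeneous_part n d. l ^ s * p - q \<in> null_on S"
    using C unfolding centred_def S_def by blast+
  note Smult = null_on_standard_mult[of _ n Q, folded S_def]
  note Tmult = null_on_standard_mult[of _ "Suc n" "insert (Poly_Mapping.single n 2) Q", folded T_def]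
  have x2: "x ^ 2 * g \<in> null_on T" for g :: "(nat \<Rightarrow>\<^sub>0 nat) \<Rightarrow>\<^sub>0 'k"
  proof -
    have "x ^ 2 = Poly_Mapping.single (Poly_Mapping.single n 2) 1"
      by (simp add: x_def e_def power2_eq_square mult_single flip: single_add one_add_one)
    moreover have "Poly_Mapping.single n 2 \<notin> T"
      by (auto simp: T_def standard_def intro: exI[of _ 0])
    ultimately have "x ^ 2 \<in> null_on T"
      by (auto simp: null_on_def lookup_single when_def)
    then show ?thesis
      using Tmult[of "x ^ 2" g] by (simp add: mult.commute)
  qed
  have lh: "l ^ s * u \<in> homogeneous_part n (s + d)" if "u \<in> homogeneous_part n d" for s u d
    using homogeneous_part_mult[OF homogeneous_part_power[OF l]] that by blast
  have nh: "of_nat k * u \<in> homogeneous_part n d" if "u \<in> homogeneous_part n d" for k u d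
    using homogeneous_part_mult[OF homogeneous_part_of_nat that] by simp
  have uv: "u + x * v \<in> null_on T \<longleftrightarrow> u \<in> null_on S \<and> v \<in> null_on S"
    if "u \<in> homogeneous_part n d" "v \<in> homogeneous_part n d'" for u v d d'
    unfolding TS x_def e_def
    by (rule null_on_cone_iff) (use that Skeys in \<open>auto dest: homogeneous_part_carrier\<close>)
  have pow: "\<exists>g. (l + x) ^ Suc s * (u + x * v) =
      l ^ Suc s * u + x * (l ^ Suc s * v + of_nat (Suc s) * (l ^ s * u)) + x ^ 2 * g" for s u v
  proof -
    obtain g where "(l + x) ^ Suc s = l ^ Suc s + of_nat (Suc s) * x * l ^ s + x ^ 2 * g"
      using power_Suc_add_mod_square by blast
    then have "(l + x) ^ Suc s * (u + x * v) = l ^ Suc s * u + x * (l ^ Suc s * v + of_nat (Suc s) * (l ^ s * u))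
       + x ^ 2 * (of_nat (Suc s) * l ^ s * v + g * (u + x * v))"
      by (simp only:) (simp add: algebra_simps power2_eq_square)
    then show ?thesis by blast
  qed
  have deg': "mon_degree m \<le> Suc c" if "m \<in> T" for m
    using that deg unfolding TS by (auto simp: mon_degree_add e_def intro: le_SucI)
  have decomp: "\<exists>u\<in>homogeneous_part n d. \<exists>v\<in>homogeneous_part n (d - 1). (d = 0 \<longrightarrow> v = 0) \<and>
      p - (u + x * v) \<in> null_on T" if "p \<in> homogeneous_part (Suc n) d" for p d
    unfolding TS x_def e_def by (rule cone_decomposition[OF that Skeys])
  have inj': "p \<in> null_on T"
    if le: "2 * d + s \<le> Suc c" and p: "p \<in> homogeneous_part (Suc n) d" and np: "(l + x) ^ s * p \<in> null_on T" for d s p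
  proof (cases s)
    case 0
    then show ?thesis using np by simp
  next
    case (Suc s')
    obtain u v where u: "u \<in> homogeneous_part n d" and v: "v \<in> homogeneous_part n (d - 1)"
      and v0: "d = 0 \<Longrightarrow> v = 0" and puv: "p - (u + x * v) \<in> null_on T"
      using decomp[OF p] by blast
    have "(l + x) ^ s * (u + x * v) \<in> null_on T"
      using null_on_diff[OF np Tmult[OF puv, of "(l + x) ^ s"]] by (simp add: algebra_simps)
    then have "l ^ s * u + x * (l ^ s * v + of_nat s * (l ^ s' * u)) \<in> null_on T"
      using pow[of s' u v] x2 null_on_add_iff unfolding Suc by metis
    \<comment> \<open>For \<open>d = 0\<close> the degree bookkeeping of \<open>l ^ s * v\<close>
      fails because of the truncated \<open>d - 1\<close>, but there \<open>v = 0\<close>.\<close>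
    moreover have "l ^ s * v + of_nat s * (l ^ s' * u) \<in> homogeneous_part n (s' + d)"
    proof (cases d)
      case 0
      then show ?thesis using v0 nh[OF lh[OF u, of s']] by simp
    next
      case (Suc d')
      then show ?thesis using nh[OF lh[OF u, of s']] lh[OF v, of s] \<open>s = Suc s'\<close>
        by (intro homogeneous_part_add) (auto simp del: of_nat_Suc)
    qed
    ultimately have nu: "l ^ s * u \<in> null_on S" and nv: "l ^ s * v + of_nat s * (l ^ s' * u) \<in> null_on S"
      using uv lh[OF u] by blast+
    have "v \<in> null_on S"
    proof (cases d)
      case 0
      then show ?thesis using v0 by simp
    next
      case (Suc d')
      \<comment> \<open>Multiplying the second component by \<open>l\<close> turns its
        \<open>u\<close> term into a multiple of \<open>l ^ s * u\<close>, which already vanishes;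
        this isolates \<open>v\<close>.\<close>
      have "l * (l ^ s * v + of_nat s * (l ^ s' * u)) = l ^ Suc s * v + of_nat s * (l ^ s * u)"
        by (simp add: \<open>s = Suc s'\<close> algebra_simps)
      then have "l ^ Suc s * v \<in> null_on S"
        using Smult[OF nv, of l] Smult[OF nu, of "of_nat s"] null_on_add_iff by metis
      then show ?thesis
        using inj[of "d - 1" "Suc s" v] v le Suc by simp
    qed
    moreover from this have "of_nat s * (l ^ s' * u) \<in> null_on S"
      using null_on_diff[OF nv Smult[of v "l ^ s"]] by simp
    then have "l ^ s' * u \<in> null_on S"
      by (simp add: null_on_of_nat_mult_iff Suc del: of_nat_Suc)
    then have "u \<in> null_on S"
      using inj[of d s' u] u le Suc by simp
    ultimately have "u + x * v \<in> null_on T"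
      using uv[OF u v] by simp
    then show ?thesis
      using null_on_add[OF puv] by fastforce
  qed
  have surj': "\<exists>p\<in>homogeneous_part (Suc n) d. (l + x) ^ s * p - q \<in> null_on T"
    if lt: "Suc c < 2 * d + s" and q: "q \<in> homogeneous_part (Suc n) (d + s)" for d s q
  \<comment> \<open>For \<open>s = 0\<close> the map is the identity; for \<open>d = 0\<close> the
    target degree \<open>s\<close> exceeds \<open>c + 1\<close>, where the algebra is zero.\<close>
  proof (cases "s = 0 \<or> d = 0")
    case True
    show ?thesis
    proof (cases "s = 0")
      case False
      then have "q \<in> null_on T"
        using True lt q deg' unfolding null_on_def homogeneous_part_iff
        by (auto simp flip: not_in_keys_iff_lookup_eq_zero) (metis leD)
      then show ?thesis
        by (intro bexI[of _ 0]) (simp_all add: null_on_def)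
    next
      case True
      then show ?thesis using q by (intro bexI[of _ q]) auto
    qed
  next
    case False
    then obtain s' where s: "s = Suc s'"
      using not0_implies_Suc by blast
    obtain w z where w: "w \<in> homogeneous_part n (d + s)" and z: "z \<in> homogeneous_part n (d + s - 1)"
      and qwz: "q - (w + x * z) \<in> null_on T"
      using decomp[OF q] by blast
    \<comment> \<open>The constant polynomial \<open>1 / s\<close>, available in characteristic
      zero.\<close>
    define r :: "(nat \<Rightarrow>\<^sub>0 nat) \<Rightarrow>\<^sub>0 'k" where "r = Poly_Mapping.single 0 (inverse (of_nat s))"
    have r: "of_nat s * r = 1"
      using s by (simp add: r_def mult_single del: of_nat_Suc flip: single_of_nat)
    have r0: "r \<in> homogeneous_part n 0"
      by (simp add: r_def single_homogeneous_part)
    have "r * z \<in> homogeneous_part n (d + s')"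
      using homogeneous_part_mult[OF r0 z] s by simp
    \<comment> \<open>First \<open>u\<close> is chosen to match the coefficient \<open>z\<close> of
      \<open>x\<close>, then \<open>v\<close> to repair the remaining error
      \<open>w - l ^ s * u\<close> in the part free of \<open>x\<close>.\<close>
    then obtain u where u: "u \<in> homogeneous_part n d" and nu: "l ^ s' * u - r * z \<in> null_on S"
      using surj[of d s' "r * z"] lt s by auto
    have "w - l ^ s * u \<in> homogeneous_part n ((d - 1) + Suc s)"
      using homogeneous_part_diff[of w n "d + s" "l ^ s * u"] lh[OF u, of s] w False by (simp add: add.commute)
    moreover have "c < 2 * (d - 1) + Suc s"
      using lt False by (cases d) auto
    ultimately obtain v where v: "v \<in> homogeneous_part n (d - 1)" and nv: "l ^ Suc s * v - (w - l ^ s * u) \<in> null_on S"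
      using surj by blast
    \<comment> \<open>Adding \<open>l * v\<close> to \<open>u\<close> repairs the part free of
      \<open>x\<close>; the term \<open>- s * v\<close> cancels the effect of this change on the
      coefficient of \<open>x\<close>.\<close>
    define u' where "u' = u + l * v"
    define v' where "v' = - (of_nat s * v)"
    have u': "u' \<in> homogeneous_part n d"
      using homogeneous_part_add[OF u] homogeneous_part_mult[OF l v] False by (simp add: u'_def)
    have v': "v' \<in> homogeneous_part n (d - 1)"
      using nh[OF v, of s] by (simp add: v'_def homogeneous_part_iff)
    have ns: "of_nat s * (l ^ s' * u) - z \<in> null_on S"
    proof -
      have "of_nat s * (l ^ s' * u - r * z) = of_nat s * (l ^ s' * u) - (of_nat s * r) * z"
        by (simp add: algebra_simps)
      then show ?thesis
        using Smult[OF nu, of "of_nat s"] r by simp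
    qed
    have a: "l ^ s * u' - w = l ^ Suc s * v - (w - l ^ s * u)"
      by (simp add: u'_def algebra_simps)
    have b: "l ^ s * v' + of_nat s * (l ^ s' * u') - z = of_nat s * (l ^ s' * u) - z"
      by (simp add: u'_def v'_def s algebra_simps)
    have "(l ^ s * u' - w) + x * (l ^ s * v' + of_nat s * (l ^ s' * u') - z) \<in> null_on T"
    proof (subst uv)
      show "l ^ s * u' - w \<in> homogeneous_part n (d + s)"
        using homogeneous_part_diff lh[OF u', of s] w by (metis add.commute)
      show "l ^ s * v' + of_nat s * (l ^ s' * u') - z \<in> homogeneous_part n (d + s')"
        unfolding b using homogeneous_part_diff[OF nh[OF lh[OF u]], of z s'] z s by (simp add: add.commute del: of_nat_Suc)
    qed (unfold a b, use nv ns in blast)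
    moreover obtain g where "(l + x) ^ s * (u' + x * v') =
        l ^ s * u' + x * (l ^ s * v' + of_nat s * (l ^ s' * u')) + x ^ 2 * g"
      using pow s by blast
    then have "(l + x) ^ s * (u' + x * v') - q =
        ((l ^ s * u' - w) + x * (l ^ s * v' + of_nat s * (l ^ s' * u') - z)) + x ^ 2 * g - (q - (w + x * z))"
      by (simp add: algebra_simps)
    ultimately have "(l + x) ^ s * (u' + x * v') - q \<in> null_on T"
      using null_on_diff[OF null_on_add[OF _ x2] qwz] by metis
    moreover have "u' + x * v' \<in> homogeneous_part (Suc n) d"
    proof (intro homogeneous_part_add)
      show "u' \<in> homogeneous_part (Suc n) d"
        using u' by (rule homogeneous_part_mono[rotated]) simp
      have "x \<in> homogeneous_part (Suc n) 1"
        unfolding x_def e_def by (rule single_homogeneous_part) auto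
      then show "x * v' \<in> homogeneous_part (Suc n) d"
        using homogeneous_part_mult[of x "Suc n" 1 v' "d - 1"] homogeneous_part_mono[OF _ v', of "Suc n"] False
        by simp
    qed
    ultimately show ?thesis by blast
  qed
  have "l + x \<in> homogeneous_part (Suc n) 1"
    unfolding x_def e_def using homogeneous_part_mono[OF _ l, of "Suc n"]
    by (intro homogeneous_part_add single_homogeneous_part) auto
  then show ?thesis
    using deg' inj' surj' unfolding centred_def T_def x_def e_def by blast
qed

section \<open>Quadratic monomials and quotients of top degree at most two\<close>

abbreviation var :: "nat \<Rightarrow> nat \<Rightarrow>\<^sub>0 nat" where
  "var i \<equiv> Poly_Mapping.single i (Suc 0)"

definition quadratic :: "nat \<Rightarrow> (nat \<Rightarrow>\<^sub>0 nat) set" where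
  "quadratic n = {m. Poly_Mapping.keys m \<subseteq> {..<n} \<and> mon_degree m = 2}"

lemma mon_degree_Suc:
  assumes "Suc d \<le> mon_degree m"
  obtains i m' where "i \<in> Poly_Mapping.keys m" "m = var i + m'" "d \<le> mon_degree m'"
proof -
  have "m \<noteq> 0"
    using assms by auto
  then obtain i where i: "i \<in> Poly_Mapping.keys m"
    by (meson mon_degree_eq_0_iff all_not_in_conv keys_eq_empty)
  then have m: "m = var i + (m - var i)"
    by (intro mon_split_var) (simp add: in_keys_iff)
  then have "mon_degree m = Suc (mon_degree (m - var i))"
    by (metis mon_degree_add mon_degree_single plus_1_eq_Suc One_nat_def)
  then show ?thesis
    using that[OF i m] assms by simp
qed

lemma mon_degree_1:
  assumes "mon_degree m = 1"
  obtains i where "m = var i" "i \<in> Poly_Mapping.keys m"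
proof -
  obtain i m' where "i \<in> Poly_Mapping.keys m" "m = var i + m'"
    using mon_degree_Suc[of 0 m] assms by auto
  then show ?thesis
    using that[of i] assms by (simp add: mon_degree_add)
qed

lemma var_eq_iff [simp]: "var i = var j \<longleftrightarrow> i = j"
  by (metis keys_single singleton_inject nat.distinct(1))

lemma quadratic_Suc: "quadratic (Suc n) = quadratic n \<union> (\<lambda>i. var n + var i) ` {..n}"
proof (intro equalityI subsetI)
  fix m assume m: "m \<in> quadratic (Suc n)"
  show "m \<in> quadratic n \<union> (\<lambda>i. var n + var i) ` {..n}"
  proof (cases "n \<in> Poly_Mapping.keys m")
    case True
    then have eq: "m = var n + (m - var n)"
      by (intro mon_split_var) (simp add: in_keys_iff)
    then have "mon_degree m = Suc 0 + mon_degree (m - var n)"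
      by (metis mon_degree_add mon_degree_single)
    then have "mon_degree (m - var n) = 1"
      using m by (simp add: quadratic_def)
    then obtain i where i: "m - var n = var i"
      using mon_degree_1 by metis
    then have "i \<in> Poly_Mapping.keys m"
      using eq by (metis UnCI insertI1 keys_add_mon keys_single nat.distinct(1))
    then have "i \<le> n"
      using m by (auto simp: quadratic_def)
    then show ?thesis
      using eq i by auto
  next
    case False
    then show ?thesis
      using m by (auto simp: quadratic_def lessThan_Suc)
  qed
qed (auto simp: quadratic_def mon_degree_add keys_add_mon)

text \<open>Variable \<open>n\<close> contributes \<open>n + 1\<close> new monomials, which is
  Pascal's rule for the binomial coefficient.\<close>

lemma quadratic_finite_card: "finite (quadratic n) \<and> card (quadratic n) = (n + 1) choose 2"
proof (induction n)
  case 0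
  have "quadratic 0 = {}"
    by (auto simp: quadratic_def)
  then show ?case
    by simp
next
  case (Suc n)
  have inj: "inj_on (\<lambda>i. var n + var i) {..n}"
    by (auto simp: inj_on_def)
  have "quadratic n \<inter> (\<lambda>i. var n + var i) ` {..n} = {}"
    by (auto simp: quadratic_def keys_add_mon)
  then show ?case
    using Suc by (simp add: quadratic_Suc card_Un_disjoint card_image[OF inj] numeral_2_eq_2)
qed

text \<open>The quadratic monomials left out of the generators, hence a basis of degree 2 of the
  quotient when \<open>r < n\<close>. Read as edges they form a star with centre 0.\<close>

definition star :: "nat \<Rightarrow> (nat \<Rightarrow>\<^sub>0 nat) set" where
  "star r = (\<lambda>i. var 0 + var i) ` {1..r}"

lemma star_subset_quadratic: "r < n \<Longrightarrow> star r \<subseteq> quadratic n"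
  by (auto simp: star_def quadratic_def keys_add_mon mon_degree_add)

text \<open>If three variables divided a standard monomial, each pair of them would have to contain
  \<open>x_0\<close> exactly once. Summing over the three pairs counts every occurrence twice, and 3
  is odd.\<close>

lemma standard_star_degree:
  assumes m: "m \<in> standard n (quadratic n - star r)"
  shows "mon_degree m \<le> 2"
proof (rule ccontr)
  assume "\<not> mon_degree m \<le> 2"
  then have "Suc 2 \<le> mon_degree m" by simp
  then obtain i m1 where 1: "m = var i + m1" "2 \<le> mon_degree m1"
    using mon_degree_Suc by metis
  then obtain j m2 where 2: "m1 = var j + m2" "1 \<le> mon_degree m2"
    using mon_degree_Suc[of 1 m1] by (metis Suc_1)
  then obtain k m3 where 3: "m2 = var k + m3"
    using mon_degree_Suc[of 0 m2] by (metis One_nat_def)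
  have eq: "m = var i + var j + (var k + m3)" "m = var i + var k + (var j + m3)"
    "m = var j + var k + (var i + m3)"
    by (simp_all add: 1 2 3 add_ac)
  \<comment> \<open>A quadratic divisor of a standard monomial is not a generator, so it belongs to
    the star.\<close>
  have one: "Poly_Mapping.lookup a 0 = 1" if "m = a + b" "mon_degree a = 2" for a b
  proof -
    have "Poly_Mapping.keys a \<subseteq> {..<n}"
      using m that by (auto simp: standard_def keys_add_mon)
    then have "a \<in> star r"
      using m that by (auto simp: standard_def quadratic_def)
    then show ?thesis
      by (auto simp: star_def lookup_add lookup_single)
  qed
  show False
    using one[OF eq(1)] one[OF eq(2)] one[OF eq(3)]
    by (auto simp: mon_degree_add lookup_add lookup_single when_def split: if_splits)
qed

text \<open>All generators have degree 2, so up to that degree being a multiple of a generator means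
  being equal to one.\<close>

lemma standard_iff_not_mem:
  assumes Q: "Q \<subseteq> quadratic n" and m: "Poly_Mapping.keys m \<subseteq> {..<n}" "mon_degree m \<le> 2"
  shows "m \<in> standard n Q \<longleftrightarrow> m \<notin> Q"
proof -
  have "a = 0" if "m = q + a" "q \<in> Q" for q a
    using m(2) that Q by (auto simp: quadratic_def mon_degree_add)
  then show ?thesis
    using m(1) by (auto simp: standard_def) (metis add.right_neutral)+
qed

text \<open>The quotient has dimensions 1, \<open>n\<close>, \<open>r\<close> in degrees 0, 1, 2.
  The maps that are neither identities nor into a zero space are those out of degree 0, where the
  powers of \<open>l\<close> must not vanish, and the one from degree 1 to degree 2, which must be
  onto.\<close>

lemma centred_star:
  fixes n r :: nat
  assumes r: "r < n"
  defines "l \<equiv> (\<Sum>i<n. Poly_Mapping.single (var i) 1) :: (nat \<Rightarrow>\<^sub>0 nat) \<Rightarrow>\<^sub>0 'k::field_char_0"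
  shows "centred n (standard n (quadratic n - star r)) l (if r = 0 then 1 else 2)"
proof -
  define Q where "Q = quadratic n - star r"
  define S where "S = standard n Q"
  define c :: nat where "c = (if r = 0 then 1 else 2)"
  have Sdeg: "mon_degree m \<le> 2" if "m \<in> S" for m
    using standard_star_degree that by (simp add: S_def Q_def)
  have Skeys: "Poly_Mapping.keys m \<subseteq> {..<n}" if "m \<in> S" for m
    using that by (simp add: S_def standard_def)
  have S_iff: "m \<in> S \<longleftrightarrow> m \<notin> Q" if "Poly_Mapping.keys m \<subseteq> {..<n}" "mon_degree m \<le> 2" for m
    unfolding S_def by (rule standard_iff_not_mem) (use that in \<open>auto simp: Q_def\<close>)
  have S2: "m \<in> S \<longleftrightarrow> m \<in> star r" if "mon_degree m = 2" for m
    using S_iff[of m] Skeys[of m] that star_subset_quadratic[OF r]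
    by (auto simp: Q_def quadratic_def)
  have deg: "mon_degree m \<le> c" if "m \<in> S" for m
    using Sdeg[OF that] S2[of m] that by (cases "mon_degree m = 2") (auto simp: c_def star_def)
  have l: "l \<in> homogeneous_part n 1"
  proof -
    have "(\<Sum>i\<in>A. Poly_Mapping.single (var i) 1 :: (nat \<Rightarrow>\<^sub>0 nat) \<Rightarrow>\<^sub>0 'k) \<in> homogeneous_part n 1"
      if "finite A" "A \<subseteq> {..<n}" for A
      using that by (induction A rule: finite_induct) (auto intro!: homogeneous_part_add single_homogeneous_part)
    then show ?thesis
      by (simp add: l_def)
  qed
  have lookup_l: "Poly_Mapping.lookup l (var i) = 1" if "i < n" for i
    using that by (simp add: l_def lookup_sum lookup_single when_def)
  have nonzero: "\<exists>m\<in>S. Poly_Mapping.lookup (l ^ s) m \<noteq> 0" if "s \<le> c" for s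
  proof -
    have "s = 0 \<or> s = 1 \<or> s = 2 \<and> r \<noteq> 0"
      using that unfolding c_def by (cases "r = 0") (simp_all, linarith+)
    then consider "s = 0" | "s = 1" | "s = 2" "r \<noteq> 0"
      by blast
    then show ?thesis
    proof cases
      case 1
      then show ?thesis
        using S_iff[of 0] by (intro bexI[of _ 0]) (auto simp: Q_def quadratic_def)
    next
      case 2
      then show ?thesis
        using S_iff[of "var 0"] r lookup_l[of 0]
        by (intro bexI[of _ "var 0"]) (auto simp: Q_def quadratic_def)
    next
      case 3
      \<comment> \<open>Only the summands \<open>x_0\<close> and \<open>x_1\<close> of one factor
        contribute to \<open>x_0 * x_1\<close> in \<open>l ^ 2\<close>, so its coefficient there is
        2.\<close>
      have "Poly_Mapping.lookup (Poly_Mapping.single (var i) 1 * l) (var 0 + var 1) = (if i < 2 then 1 else 0)"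
        if "i < n" for i
      proof -
        consider "i = 0" | "i = 1" | "2 \<le> i" by linarith
        then show ?thesis
        proof cases
          case 1
          then show ?thesis using lookup_single_mult[of "var 0" 1 l "var 1"] lookup_l[of 1] r 3 by simp
        next
          case 2
          then show ?thesis using lookup_single_mult[of "var 1" 1 l "var 0"] lookup_l[of 0] r
            by (simp add: add.commute)
        next
          case 3
          have "Poly_Mapping.lookup (Poly_Mapping.single (var i) 1 * l) (var 0 + var 1) = 0"
          proof (rule lookup_single_mult_eq_0)
            fix b
            have "Poly_Mapping.lookup (var 0 + var 1) i \<noteq> Poly_Mapping.lookup (var i + b) i"
              using 3 by (simp add: lookup_add lookup_single)
            then show "var 0 + var 1 \<noteq> var i + b" by auto
          qed
          then show ?thesis using 3 by simp
        qed
      qed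
      then have "(\<Sum>i<n. Poly_Mapping.lookup (Poly_Mapping.single (var i) 1 * l) (var 0 + var 1)) =
          (\<Sum>i<n. if i < 2 then 1 else 0 :: 'k)"
        by simp
      also have "\<dots> = (\<Sum>i<2::nat. 1)"
        using r 3 by (intro sum.mono_neutral_cong_right) auto
      finally have "Poly_Mapping.lookup (l ^ 2) (var 0 + var 1) = 2"
        by (simp add: power2_eq_square lookup_sum l_def sum_distrib_right)
      moreover have "var 0 + var 1 \<in> S"
        using S2[of "var 0 + var 1"] 3 by (auto simp: star_def mon_degree_add)
      ultimately show ?thesis
        using 3 by (intro bexI[of _ "var 0 + var 1"]) auto
    qed
  qed
  have inj: "p \<in> null_on S"
    if le: "2 * d + s \<le> c" and p: "p \<in> homogeneous_part n d" and np: "l ^ s * p \<in> null_on S" for d s p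
  proof (cases "s = 0")
    case True
    then show ?thesis using np by simp
  next
    case False
    then have "d = 0" using le by (auto simp: c_def split: if_splits)
    have "Poly_Mapping.lookup p k = (if k = 0 then Poly_Mapping.lookup p 0 else 0)" for k
      using p \<open>d = 0\<close> by (auto simp: homogeneous_part_iff simp flip: not_in_keys_iff_lookup_eq_zero)
    then have p0: "p = Poly_Mapping.single 0 (Poly_Mapping.lookup p 0)"
      by (intro poly_mapping_eqI) (metis lookup_single_eq lookup_single_not_eq)
    obtain m where m: "m \<in> S" "Poly_Mapping.lookup (l ^ s) m \<noteq> 0"
      using nonzero[of s] le by auto
    have "Poly_Mapping.lookup (l ^ s * p) m = Poly_Mapping.lookup p 0 * Poly_Mapping.lookup (l ^ s) m"
      using lookup_single_mult[of 0 "Poly_Mapping.lookup p 0" "l ^ s" m] p0 by (simp add: mult.commute)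
    then have "Poly_Mapping.lookup p 0 = 0"
      using m np by (simp add: null_on_def)
    then show ?thesis
      using p0 by simp
  qed
  have surj: "\<exists>p\<in>homogeneous_part n d. l ^ s * p - q \<in> null_on S"
    if lt: "c < 2 * d + s" and q: "q \<in> homogeneous_part n (d + s)" for d s q
  proof -
    \<comment> \<open>Apart from identities and zero targets, only the map from degree 1 to degree 2
      remains.\<close>
    have "s = 0 \<or> c < d + s \<or> d = 1 \<and> s = 1 \<and> r \<noteq> 0"
      using lt unfolding c_def by (cases "r = 0") (simp_all, linarith+)
    then consider "s = 0" | "c < d + s" | "d = 1" "s = 1" "r \<noteq> 0"
      by blast
    then show ?thesis
    proof cases
      case 1
      then show ?thesis using q by (intro bexI[of _ q]) auto
    next
      case 2
      have "q \<in> null_on S"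
        using 2 q deg unfolding null_on_def homogeneous_part_iff
        by (auto simp flip: not_in_keys_iff_lookup_eq_zero) (metis leD)
      then show ?thesis
        by (intro bexI[of _ 0]) (auto simp: null_on_def)
    next
      case 3
      show ?thesis
        using q
      proof (induction rule: homogeneous_part_induct)
        case zero
        show ?case by (intro bexI[of _ 0]) auto
      next
        case (add q q')
        then obtain p p' where "p \<in> homogeneous_part n d" "p' \<in> homogeneous_part n d"
          "l ^ s * p - q \<in> null_on S" "l ^ s * p' - q' \<in> null_on S"
          by blast
        then show ?case
          using null_on_add[of "l ^ s * p - q" S "l ^ s * p' - q'"]
          by (intro bexI[of _ "p + p'"]) (auto simp: algebra_simps intro: homogeneous_part_add)
      next
        case (single m k)
        show ?case
        proof (cases "m \<in> S")
          case False
          then show ?thesis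
            by (intro bexI[of _ 0]) (auto simp: null_on_def lookup_single when_def)
        next
          case True
          then obtain t where t: "t \<in> {1..r}" "m = var 0 + var t"
            using S2[of m] single 3 by (auto simp: star_def)
          \<comment> \<open>Since \<open>t\<close> is at least 1, the only star monomial divisible
            by \<open>x_t\<close> is \<open>x_0 * x_t\<close>, so \<open>l * x_t\<close> reduces to
            it.\<close>
          define p :: "(nat \<Rightarrow>\<^sub>0 nat) \<Rightarrow>\<^sub>0 'k" where "p = Poly_Mapping.single (var t) k"
          have p: "p \<in> homogeneous_part n 1"
            using t r by (auto simp: p_def intro!: single_homogeneous_part)
          have "Poly_Mapping.lookup (l * p) m' = Poly_Mapping.lookup (Poly_Mapping.single m k) m'"
            if m': "m' \<in> S" for m'
          proof (cases "mon_degree m' = 2")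
            case False
            moreover have "l * p \<in> homogeneous_part n 2"
              using homogeneous_part_mult[OF l p] by (simp add: numeral_2_eq_2)
            moreover have "mon_degree m = 2"
              using single 3 by simp
            ultimately show ?thesis
              by (auto simp: homogeneous_part_iff in_keys_iff lookup_single when_def)
          next
            case True
            then obtain t' where t': "t' \<in> {1..r}" "m' = var 0 + var t'"
              using S2[of m'] m' by (auto simp: star_def)
            show ?thesis
            proof (cases "t' = t")
              case True
              then show ?thesis
                using t t' lookup_single_mult[of "var t" k l "var 0"] lookup_l[of 0] r
                by (simp add: p_def mult.commute add.commute)
            next
              case False
              have "m' \<noteq> var t + b" for b
              proof
                assume "m' = var t + b"
                then have "Poly_Mapping.lookup (var 0 + var t') t = Poly_Mapping.lookup (var t + b) t"
                  using t' by simp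
                then show False
                  using False t by (simp add: lookup_add lookup_single)
              qed
              then have "Poly_Mapping.lookup (l * p) m' = 0"
                unfolding p_def by (subst mult.commute) (rule lookup_single_mult_eq_0)
              moreover have "m \<noteq> m'"
                using False t t' by simp
              ultimately show ?thesis
                by (simp add: lookup_single)
            qed
          qed
          then show ?thesis
            using p 3 by (intro bexI[of _ p]) (auto simp: null_on_def lookup_minus)
        qed
      qed
    qed
  qed
  show ?thesis
    using l deg inj surj unfolding centred_def S_def Q_def c_def by blast
qed

text \<open>The squares are carried along because they bound the standard monomials and so make the
  quotient artinian.\<close>

lemma exists_centred:
  assumes "n \<le> \<mu>" "\<mu> \<le> (n + 1) choose 2"
  shows "\<exists>Q l c. Q \<subseteq> quadratic n \<and> (\<forall>i<n. Poly_Mapping.single i 2 \<in> Q) \<and> card Q = \<mu> \<and>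
    centred n (standard n Q) (l :: (nat \<Rightarrow>\<^sub>0 nat) \<Rightarrow>\<^sub>0 'k::field_char_0) c"
  using assms
proof (induction n arbitrary: \<mu>)
  case 0
  \<comment> \<open>Without variables the quotient is the field itself in degree 0, and
    \<open>l = 0\<close> with \<open>c = 0\<close> will do.\<close>
  have "centred 0 (standard 0 {}) (0 :: (nat \<Rightarrow>\<^sub>0 nat) \<Rightarrow>\<^sub>0 'k) 0"
  proof -
    have *: "standard 0 {} = {0}"
      by (auto simp: standard_def)
    have "\<exists>p\<in>homogeneous_part 0 d. 0 ^ s * p - q \<in> null_on {0}"
      if "0 < 2 * d + s" "q \<in> homogeneous_part 0 (d + s)" for d s and q :: "(nat \<Rightarrow>\<^sub>0 nat) \<Rightarrow>\<^sub>0 'k"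
    proof -
      have "q \<in> null_on {0}"
        using that by (auto simp: null_on_def homogeneous_part_iff simp flip: not_in_keys_iff_lookup_eq_zero)
      then show ?thesis
        by (intro bexI[of _ 0]) (auto simp: null_on_def)
    qed
    then show ?thesis
      by (auto simp: centred_def *)
  qed
  then show ?case
    using 0 by (intro exI[of _ "{}"]) (auto simp: numeral_2_eq_2)
next
  case (Suc n)
  have choose: "(Suc n + 1) choose 2 = ((n + 1) choose 2) + Suc n"
    by (simp add: numeral_2_eq_2)
  show ?case
  \<comment> \<open>One generator is reserved for the new square. If the other
    \<open>\<mu> - 1\<close> fit into \<open>n\<close> variables the cone applies; otherwise few
    enough quadratic monomials are missing for them to form a star.\<close>
  proof (cases "\<mu> - 1 \<le> (n + 1) choose 2")
    case True
    have "n \<le> \<mu> - 1"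
      using Suc.prems(1) by simp
    from Suc.IH[OF this True] obtain Q l c where Q: "Q \<subseteq> quadratic n" "\<forall>i<n. Poly_Mapping.single i 2 \<in> Q" "card Q = \<mu> - 1"
      and C: "centred n (standard n Q) (l :: (nat \<Rightarrow>\<^sub>0 nat) \<Rightarrow>\<^sub>0 'k) c"
      by (elim exE conjE) rule
    have keys: "Poly_Mapping.keys q \<subseteq> {..<n}" if "q \<in> Q" for q
      using Q(1) that by (auto simp: quadratic_def)
    have "finite Q"
      using Q(1) quadratic_finite_card finite_subset by blast
    moreover have "Poly_Mapping.single n 2 \<notin> Q"
      using keys by fastforce
    ultimately have "card (insert (Poly_Mapping.single n 2) Q) = \<mu>"
      using Q(3) Suc.prems(1) by simp
    moreover have "Poly_Mapping.single n 2 \<in> quadratic (Suc n)"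
      by (simp add: quadratic_def)
    then have "insert (Poly_Mapping.single n 2) Q \<subseteq> quadratic (Suc n)"
      using Q(1) quadratic_Suc by blast
    moreover have "\<forall>i<Suc n. Poly_Mapping.single i 2 \<in> insert (Poly_Mapping.single n 2) Q"
      using Q(2) by (auto simp: less_Suc_eq)
    ultimately show ?thesis
      using centred_cone[OF keys C] by blast
  next
    case False
    define r where "r = ((Suc n + 1) choose 2) - \<mu>"
    have r: "r < Suc n"
      using False choose by (simp add: r_def)
    have star: "finite (star r)" "card (star r) = r"
      by (auto simp: star_def card_image inj_on_def)
    define Q where "Q = quadratic (Suc n) - star r"
    have "card Q = \<mu>"
      using quadratic_finite_card[of "Suc n"] star star_subset_quadratic[OF r] Suc.prems(2)
      by (simp add: Q_def card_Diff_subset r_def)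
    moreover have "Poly_Mapping.single i 2 \<notin> star r" for i
    proof
      assume "Poly_Mapping.single i 2 \<in> star r"
      then obtain j where j: "j \<in> {1..r}" "Poly_Mapping.single i 2 = var 0 + var j"
        by (auto simp: star_def)
      then have "Poly_Mapping.keys (Poly_Mapping.single i (2::nat)) = {0, j}"
        by (auto simp: keys_add_mon)
      then show False
        using j(1) by auto
    qed
    then have "\<forall>i<Suc n. Poly_Mapping.single i 2 \<in> Q"
      by (auto simp: Q_def quadratic_def)
    moreover have "Q \<subseteq> quadratic (Suc n)"
      by (auto simp: Q_def)
    ultimately show ?thesis
      using centred_star[OF r] unfolding Q_def by blast
  qed
qed

section \<open>Monomial ideals and their quotient rings\<close>

text \<open>Given by coefficients rather than generators, so that membership matches
  \<open>null_on\<close>; \<open>genideal_monomials\<close> supplies the generators.\<close>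

definition monomial_ideal :: "nat \<Rightarrow> (nat \<Rightarrow>\<^sub>0 nat) set \<Rightarrow> ((nat \<Rightarrow>\<^sub>0 nat) \<Rightarrow>\<^sub>0 'k::field) set" where
  "monomial_ideal n Q = carrier (mpoly_ring n) \<inter> null_on (standard n Q)"

lemma ring_mpoly_ring: "ring (mpoly_ring n)"
  by (rule cring.axioms(1)) (rule mpoly_ring_cring)

lemma carrier_mpoly_ring_closed:
  fixes p q :: "(nat \<Rightarrow>\<^sub>0 nat) \<Rightarrow>\<^sub>0 'k::field"
  shows "0 \<in> carrier (mpoly_ring n)" "1 \<in> carrier (mpoly_ring n)"
    "p \<in> carrier (mpoly_ring n) \<Longrightarrow> - p \<in> carrier (mpoly_ring n)"
    "p \<in> carrier (mpoly_ring n) \<Longrightarrow> q \<in> carrier (mpoly_ring n) \<Longrightarrow> p + q \<in> carrier (mpoly_ring n)"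
    "p \<in> carrier (mpoly_ring n) \<Longrightarrow> q \<in> carrier (mpoly_ring n) \<Longrightarrow> p - q \<in> carrier (mpoly_ring n)"
    "p \<in> carrier (mpoly_ring n) \<Longrightarrow> q \<in> carrier (mpoly_ring n) \<Longrightarrow> p * q \<in> carrier (mpoly_ring n)"
proof -
  interpret ring "mpoly_ring n :: ((nat \<Rightarrow>\<^sub>0 nat) \<Rightarrow>\<^sub>0 'k) ring"
    by (rule ring_mpoly_ring)
  show "0 \<in> carrier (mpoly_ring n)" "1 \<in> carrier (mpoly_ring n)"
    and neg: "p \<in> carrier (mpoly_ring n) \<Longrightarrow> - p \<in> carrier (mpoly_ring n)" for p :: "(nat \<Rightarrow>\<^sub>0 nat) \<Rightarrow>\<^sub>0 'k"
    by (simp_all add: carrier_mpoly_ring)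
  show add: "p \<in> carrier (mpoly_ring n) \<Longrightarrow> q \<in> carrier (mpoly_ring n) \<Longrightarrow> p + q \<in> carrier (mpoly_ring n)"
    and "p \<in> carrier (mpoly_ring n) \<Longrightarrow> q \<in> carrier (mpoly_ring n) \<Longrightarrow> p * q \<in> carrier (mpoly_ring n)"
    for p q :: "(nat \<Rightarrow>\<^sub>0 nat) \<Rightarrow>\<^sub>0 'k"
    using add.m_closed[of p q] m_closed[of p q] by simp_all
  show "p \<in> carrier (mpoly_ring n) \<Longrightarrow> q \<in> carrier (mpoly_ring n) \<Longrightarrow> p - q \<in> carrier (mpoly_ring n)"
    using add[of p "- q"] neg by simp
qed

lemma a_inv_mpoly_ring:
  fixes p :: "(nat \<Rightarrow>\<^sub>0 nat) \<Rightarrow>\<^sub>0 'k::field"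
  assumes "p \<in> carrier (mpoly_ring n)"
  shows "\<ominus>\<^bsub>mpoly_ring n\<^esub> p = - p"
proof -
  interpret ring "mpoly_ring n :: ((nat \<Rightarrow>\<^sub>0 nat) \<Rightarrow>\<^sub>0 'k) ring"
    by (rule ring_mpoly_ring)
  show ?thesis
    by (rule minus_equality) (simp_all add: assms carrier_mpoly_ring_closed)
qed

lemma nat_pow_mpoly_ring: "p [^]\<^bsub>mpoly_ring n\<^esub> (s::nat) = p ^ s"
  by (induction s) (simp_all add: nat_pow_def mult.commute)

lemma ideal_monomial_ideal:
  "ideal (monomial_ideal n Q :: ((nat \<Rightarrow>\<^sub>0 nat) \<Rightarrow>\<^sub>0 'k::field) set) (mpoly_ring n)"
proof -
  interpret ring "mpoly_ring n :: ((nat \<Rightarrow>\<^sub>0 nat) \<Rightarrow>\<^sub>0 'k) ring"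
    by (rule ring_mpoly_ring)
  have neg: "- p \<in> monomial_ideal n Q" if "p \<in> monomial_ideal n Q" for p :: "(nat \<Rightarrow>\<^sub>0 nat) \<Rightarrow>\<^sub>0 'k"
    using that null_on_diff[of 0 "standard n Q" p]
    by (simp add: monomial_ideal_def carrier_mpoly_ring_closed)
  show ?thesis
  proof (rule idealI)
    show "subgroup (monomial_ideal n Q) (add_monoid (mpoly_ring n :: ((nat \<Rightarrow>\<^sub>0 nat) \<Rightarrow>\<^sub>0 'k) ring))"
    proof (rule add.subgroupI)
      show "monomial_ideal n Q \<noteq> ({} :: ((nat \<Rightarrow>\<^sub>0 nat) \<Rightarrow>\<^sub>0 'k) set)"
        using carrier_mpoly_ring_closed(1) null_on_zero unfolding monomial_ideal_def by blast
      show "\<ominus>\<^bsub>mpoly_ring n\<^esub> p \<in> monomial_ideal n Q"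
        if "p \<in> monomial_ideal n Q" for p :: "(nat \<Rightarrow>\<^sub>0 nat) \<Rightarrow>\<^sub>0 'k"
        using neg[OF that] a_inv_mpoly_ring[of p n] that by (simp add: monomial_ideal_def)
    qed (auto simp: monomial_ideal_def intro: null_on_add carrier_mpoly_ring_closed)
    fix a p :: "(nat \<Rightarrow>\<^sub>0 nat) \<Rightarrow>\<^sub>0 'k"
    assume "a \<in> monomial_ideal n Q" "p \<in> carrier (mpoly_ring n)"
    then have "p * a \<in> monomial_ideal n Q"
      by (simp add: monomial_ideal_def null_on_standard_mult carrier_mpoly_ring_closed)
    then show "p \<otimes>\<^bsub>mpoly_ring n\<^esub> a \<in> monomial_ideal n Q" "a \<otimes>\<^bsub>mpoly_ring n\<^esub> p \<in> monomial_ideal n Q"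
      by (simp_all add: mult.commute)
  qed (rule ring_axioms)
qed

lemma single_monomial_ideal_iff:
  "Poly_Mapping.keys m \<subseteq> {..<n} \<Longrightarrow>
    Poly_Mapping.single m (1::'k::field) \<in> monomial_ideal n Q \<longleftrightarrow> m \<notin> standard n Q"
  by (auto simp: monomial_ideal_def carrier_mpoly_ring null_on_def lookup_single when_def)

text \<open>Every term of a member sits at a nonstandard monomial and is therefore a multiple of a
  generator.\<close>

lemma genideal_monomials:
  assumes Q: "\<And>q. q \<in> Q \<Longrightarrow> Poly_Mapping.keys q \<subseteq> {..<n}"
  shows "Idl\<^bsub>mpoly_ring n\<^esub> ((\<lambda>q. Poly_Mapping.single q 1) ` Q) = (monomial_ideal n Q :: ((nat \<Rightarrow>\<^sub>0 nat) \<Rightarrow>\<^sub>0 'k::field) set)"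
    (is "?J = ?I")
proof
  interpret ring "mpoly_ring n :: ((nat \<Rightarrow>\<^sub>0 nat) \<Rightarrow>\<^sub>0 'k) ring"
    by (rule ring_mpoly_ring)
  have G: "(\<lambda>q. Poly_Mapping.single q 1) ` Q \<subseteq> carrier (mpoly_ring n :: ((nat \<Rightarrow>\<^sub>0 nat) \<Rightarrow>\<^sub>0 'k) ring)"
    using Q by (auto simp: carrier_mpoly_ring)
  interpret J: ideal ?J "mpoly_ring n :: ((nat \<Rightarrow>\<^sub>0 nat) \<Rightarrow>\<^sub>0 'k) ring"
    by (rule genideal_ideal[OF G])
  have "q \<notin> standard n Q" if "q \<in> Q" for q
    using that by (auto simp: standard_def intro!: exI[of _ 0] bexI[of _ q])
  then show "?J \<subseteq> ?I"
    using Q by (intro genideal_minimal ideal_monomial_ideal) (auto simp: single_monomial_ideal_iff)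
  show "?I \<subseteq> ?J"
  proof
    fix p :: "(nat \<Rightarrow>\<^sub>0 nat) \<Rightarrow>\<^sub>0 'k" assume p: "p \<in> ?I"
    have "Poly_Mapping.keys p \<subseteq> {m. Poly_Mapping.keys m \<subseteq> {..<n} \<and> m \<notin> standard n Q}"
      using p by (auto simp: monomial_ideal_def carrier_mpoly_ring null_on_def)
    then show "p \<in> ?J"
    proof (induction rule: poly_induct)
      case zero
      show ?case using J.zero_closed by simp
    next
      case (add p q)
      then show ?case using J.a_closed[of p q] by simp
    next
      case (single m c)
      then obtain q a where qa: "q \<in> Q" "m = q + a"
        by (auto simp: standard_def)
      have "Poly_Mapping.single q 1 \<in> ?J"
        using genideal_self[OF G] qa by blast
      moreover have "Poly_Mapping.single a c \<in> carrier (mpoly_ring n)"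
        using single qa by (auto simp: carrier_mpoly_ring keys_add_mon)
      ultimately have "Poly_Mapping.single a c * Poly_Mapping.single q 1 \<in> ?J"
        using J.I_l_closed by fastforce
      then show ?case
        using qa by (simp add: mult_single add.commute)
    qed
  qed
qed

text \<open>Generators of equal degree do not divide one another, so an omitted \<open>q\<close> is
  standard for the remaining ones and leaves the ideal.\<close>

lemma minimally_generates_monomial_ideal:
  assumes Q: "Q \<subseteq> quadratic n"
  shows "minimally_generates (mpoly_ring n) ((\<lambda>q. Poly_Mapping.single q 1) ` Q)
    (monomial_ideal n Q :: ((nat \<Rightarrow>\<^sub>0 nat) \<Rightarrow>\<^sub>0 'k::field) set)"
proof -
  have keys: "Poly_Mapping.keys q \<subseteq> {..<n}" if "q \<in> Q" for q
    using Q that by (auto simp: quadratic_def)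
  have "Idl\<^bsub>mpoly_ring n\<^esub> H \<noteq> (monomial_ideal n Q :: ((nat \<Rightarrow>\<^sub>0 nat) \<Rightarrow>\<^sub>0 'k) set)"
    if H: "H \<subset> (\<lambda>q. Poly_Mapping.single q 1) ` Q" for H :: "((nat \<Rightarrow>\<^sub>0 nat) \<Rightarrow>\<^sub>0 'k) set"
  proof -
    define P where "P = {q\<in>Q. Poly_Mapping.single q (1::'k) \<in> H}"
    have HP: "H = (\<lambda>q. Poly_Mapping.single q 1) ` P"
      using H unfolding P_def by blast
    obtain q where q: "q \<in> Q" "q \<notin> P"
      using H unfolding HP by blast
    have "q \<in> standard n P"
      using q Q by (subst standard_iff_not_mem) (auto simp: P_def quadratic_def)
    moreover have "q \<notin> standard n Q"
      using q Q by (subst standard_iff_not_mem) (auto simp: quadratic_def)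
    ultimately have "monomial_ideal n P \<noteq> (monomial_ideal n Q :: ((nat \<Rightarrow>\<^sub>0 nat) \<Rightarrow>\<^sub>0 'k) set)"
      using single_monomial_ideal_iff[OF keys[OF q(1)]] by metis
    moreover have "Idl\<^bsub>mpoly_ring n\<^esub> H = monomial_ideal n P"
      unfolding HP by (rule genideal_monomials) (auto simp: P_def keys)
    ultimately show ?thesis by simp
  qed
  then show ?thesis
    unfolding minimally_generates_def using genideal_monomials[OF keys] keys
    by (auto simp: carrier_mpoly_ring)
qed

text \<open>Translates equality in the quotient ring into the condition on coefficients that
  \<open>centred\<close> uses.\<close>

lemma coset_eq_iff:
  fixes p q :: "(nat \<Rightarrow>\<^sub>0 nat) \<Rightarrow>\<^sub>0 'k::field"
  assumes "p \<in> carrier (mpoly_ring n)" "q \<in> carrier (mpoly_ring n)"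
  shows "monomial_ideal n Q +>\<^bsub>mpoly_ring n\<^esub> p = monomial_ideal n Q +>\<^bsub>mpoly_ring n\<^esub> q \<longleftrightarrow>
    p - q \<in> null_on (standard n Q)"
  using ring.quotient_eq_iff_same_a_r_cos[OF ring_mpoly_ring ideal_monomial_ideal assms, of Q] assms
  by (simp add: a_minus_def a_inv_mpoly_ring monomial_ideal_def carrier_mpoly_ring_closed)

text \<open>The comparison of \<open>2 * d + s\<close> with \<open>c\<close> decides which
  alternative of full rank holds; the class of \<open>l\<close> is the Lefschetz element.\<close>

lemma strong_lefschetz_centred:
  assumes C: "centred n (standard n Q) (l :: (nat \<Rightarrow>\<^sub>0 nat) \<Rightarrow>\<^sub>0 'k::field) c"
  shows "strong_lefschetz (mpoly_ring n Quot monomial_ideal n Q) (quotient_part n (monomial_ideal n Q :: ((nat \<Rightarrow>\<^sub>0 nat) \<Rightarrow>\<^sub>0 'k) set))"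
proof -
  let ?R = "mpoly_ring n :: ((nat \<Rightarrow>\<^sub>0 nat) \<Rightarrow>\<^sub>0 'k) ring"
  let ?I = "monomial_ideal n Q :: ((nat \<Rightarrow>\<^sub>0 nat) \<Rightarrow>\<^sub>0 'k) set"
  let ?A = "?R Quot ?I"
  interpret I: ideal ?I ?R
    by (rule ideal_monomial_ideal)
  interpret h: ring_hom_ring ?R ?A "(+>\<^bsub>?R\<^esub>) ?I"
    by (rule I.rcos_ring_hom_ring)
  have l: "l \<in> homogeneous_part n 1"
    using C by (simp add: centred_def)
  have mult: "((?I +>\<^bsub>?R\<^esub> l) [^]\<^bsub>?A\<^esub> s) \<otimes>\<^bsub>?A\<^esub> (?I +>\<^bsub>?R\<^esub> p) = ?I +>\<^bsub>?R\<^esub> (l ^ s * p)"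
    if "p \<in> homogeneous_part n d" for s :: nat and p d
  proof -
    have *: "l \<in> carrier ?R" "l ^ s \<in> carrier ?R" "p \<in> carrier ?R"
      using l that homogeneous_part_power[OF l, of s] homogeneous_part_carrier by blast+
    show ?thesis
      using h.hom_nat_pow[OF *(1), of s] h.hom_mult[OF *(2,3)] by (simp add: nat_pow_mpoly_ring)
  qed
  have pc: "l ^ s * p \<in> homogeneous_part n (d + s)" if "p \<in> homogeneous_part n d" for s p d
    using homogeneous_part_mult[OF homogeneous_part_power[OF l] that, of s] by (simp add: add.commute)
  have "inj_on (\<lambda>a. ((?I +>\<^bsub>?R\<^esub> l) [^]\<^bsub>?A\<^esub> s) \<otimes>\<^bsub>?A\<^esub> a) (quotient_part n ?I d) \<or>
    (\<lambda>a. ((?I +>\<^bsub>?R\<^esub> l) [^]\<^bsub>?A\<^esub> s) \<otimes>\<^bsub>?A\<^esub> a) ` quotient_part n ?I d = quotient_part n ?I (d + s)" for s d :: nat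
  proof (cases "2 * d + s \<le> c")
    case True
    have "inj_on (\<lambda>a. ((?I +>\<^bsub>?R\<^esub> l) [^]\<^bsub>?A\<^esub> s) \<otimes>\<^bsub>?A\<^esub> a) (quotient_part n ?I d)"
    proof (rule inj_onI)
      fix a b assume "a \<in> quotient_part n ?I d" "b \<in> quotient_part n ?I d"
        and eq: "((?I +>\<^bsub>?R\<^esub> l) [^]\<^bsub>?A\<^esub> s) \<otimes>\<^bsub>?A\<^esub> a = ((?I +>\<^bsub>?R\<^esub> l) [^]\<^bsub>?A\<^esub> s) \<otimes>\<^bsub>?A\<^esub> b"
      then obtain p q where p: "p \<in> homogeneous_part n d" "a = ?I +>\<^bsub>?R\<^esub> p"
        and q: "q \<in> homogeneous_part n d" "b = ?I +>\<^bsub>?R\<^esub> q"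
        by (auto simp: quotient_part_def)
      have "l ^ s * p - l ^ s * q \<in> null_on (standard n Q)"
        using eq pc[OF p(1), of s] pc[OF q(1), of s] unfolding p(2) q(2) mult[OF p(1)] mult[OF q(1)]
        by (subst (asm) coset_eq_iff) (auto dest: homogeneous_part_carrier)
      then have "l ^ s * (p - q) \<in> null_on (standard n Q)"
        by (simp add: algebra_simps)
      then have "p - q \<in> null_on (standard n Q)"
        using C True homogeneous_part_diff[OF p(1) q(1)] unfolding centred_def by blast
      then show "a = b"
        unfolding p(2) q(2) using p(1) q(1)
        by (subst coset_eq_iff) (auto dest: homogeneous_part_carrier)
    qed
    then show ?thesis ..
  next
    case False
    have "(\<lambda>a. ((?I +>\<^bsub>?R\<^esub> l) [^]\<^bsub>?A\<^esub> s) \<otimes>\<^bsub>?A\<^esub> a) ` quotient_part n ?I d = quotient_part n ?I (d + s)"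
    proof (intro equalityI subsetI)
      fix a assume "a \<in> (\<lambda>a. ((?I +>\<^bsub>?R\<^esub> l) [^]\<^bsub>?A\<^esub> s) \<otimes>\<^bsub>?A\<^esub> a) ` quotient_part n ?I d"
      then show "a \<in> quotient_part n ?I (d + s)"
        using pc mult unfolding quotient_part_def by auto
    next
      fix b assume "b \<in> quotient_part n ?I (d + s)"
      then obtain q where q: "q \<in> homogeneous_part n (d + s)" "b = ?I +>\<^bsub>?R\<^esub> q"
        by (auto simp: quotient_part_def)
      then obtain p where p: "p \<in> homogeneous_part n d" "l ^ s * p - q \<in> null_on (standard n Q)"
        using C False unfolding centred_def by (meson not_le)
      have "?I +>\<^bsub>?R\<^esub> (l ^ s * p) = b"
        unfolding q(2) using p(2) q(1) pc[OF p(1), of s]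
        by (subst coset_eq_iff) (auto dest: homogeneous_part_carrier)
      then show "b \<in> (\<lambda>a. ((?I +>\<^bsub>?R\<^esub> l) [^]\<^bsub>?A\<^esub> s) \<otimes>\<^bsub>?A\<^esub> a) ` quotient_part n ?I d"
        using p(1) mult[OF p(1)] by (force simp: quotient_part_def)
    qed
    then show ?thesis ..
  qed
  moreover have "?I +>\<^bsub>?R\<^esub> l \<in> quotient_part n ?I 1"
    using l by (auto simp: quotient_part_def)
  ultimately show ?thesis
    unfolding strong_lefschetz_def by blast
qed

section \<open>The artinian property\<close>

text \<open>The squares force all exponents to be at most 1, so a standard monomial is determined by
  its support, a subset of \<open>{..<n}\<close>.\<close>

lemma finite_standard:
  assumes "\<And>i. i < n \<Longrightarrow> Poly_Mapping.single i 2 \<in> Q"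
  shows "finite (standard n Q)"
proof (rule finite_imageD)
  show "inj_on Poly_Mapping.keys (standard n Q)"
  proof (rule inj_onI)
    have le: "Poly_Mapping.lookup m i \<le> 1" if "m \<in> standard n Q" for m i
    proof (cases "i < n")
      case True
      have "\<not> 2 \<le> Poly_Mapping.lookup m i"
        using that assms[OF True] mon_split_var unfolding standard_def by blast
      then show ?thesis by simp
    next
      case False
      then have "i \<notin> Poly_Mapping.keys m"
        using that by (auto simp: standard_def)
      then show ?thesis
        by (simp add: in_keys_iff)
    qed
    fix m m' assume "m \<in> standard n Q" "m' \<in> standard n Q" "Poly_Mapping.keys m = Poly_Mapping.keys m'"
    then show "m = m'"
      by (intro poly_mapping_eqI) (metis One_nat_def in_keys_iff le le_Suc_eq le_zero_eq)
  qed
  show "finite (Poly_Mapping.keys ` standard n Q)"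
    by (rule finite_subset[of _ "Pow {..<n}"]) (auto simp: standard_def)
qed

text \<open>Descending chains of subspaces stabilise: compare first the values of one coordinate, which
  form \<open>0\<close> or the whole field, and then the kernels of that coordinate.\<close>

lemma descending_chain_null_on:
  fixes W :: "nat \<Rightarrow> ('a \<Rightarrow>\<^sub>0 'k::field) set"
  assumes "finite S"
    and "\<And>i. W (Suc i) \<subseteq> W i"
    and "\<And>i p q. p \<in> W i \<Longrightarrow> q \<in> W i \<Longrightarrow> p - q \<in> W i"
    and "\<And>i p c. p \<in> W i \<Longrightarrow> Poly_Mapping.map ((*) c) p \<in> W i"
    and "\<exists>k. \<forall>i\<ge>k. W i \<inter> null_on S = W k \<inter> null_on S"
  shows "\<exists>k. \<forall>i\<ge>k. W i = W k"
  using assms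
proof (induction S arbitrary: W rule: finite_induct)
  case empty
  then show ?case by (simp add: null_on_def)
next
  case (insert m S)
  have anti: "W j \<subseteq> W i" if "i \<le> j" for i j
    using that insert.prems(1) by (rule lift_Suc_antimono_le[rotated])
  define K where "K i = W i \<inter> null_on {m}" for i
  have "\<exists>k. \<forall>i\<ge>k. K i = K k"
  proof (rule insert.IH)
    show "\<exists>k. \<forall>i\<ge>k. K i \<inter> null_on S = K k \<inter> null_on S"
      using insert.prems(4) by (simp add: K_def null_on_def Int_assoc Int_def conj_assoc)
    show "K (Suc i) \<subseteq> K i" for i
      using insert.prems(1) by (auto simp: K_def)
  qed (use insert.prems in \<open>auto simp: K_def null_on_def lookup_minus Poly_Mapping.map.rep_eq when_def\<close>)
  then obtain k where k: "\<And>i. i \<ge> k \<Longrightarrow> K i = K k"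
    by blast
  \<comment> \<open>Past \<open>k'\<close> the coordinate \<open>m\<close> is either zero on every
    \<open>W i\<close> or nonzero somewhere on each of them.\<close>
  obtain k' where k': "k' \<ge> k" "\<And>i. i \<ge> k' \<Longrightarrow> W i \<subseteq> null_on {m} \<longleftrightarrow> W k' \<subseteq> null_on {m}"
  proof (cases "\<exists>j. W j \<subseteq> null_on {m}")
    case True
    then obtain j where "W j \<subseteq> null_on {m}" ..
    then have "W i \<subseteq> null_on {m}" if "i \<ge> max j k" for i
      using anti[of j i] that by auto
    then show ?thesis
      using that[of "max j k"] by simp
  next
    case False
    then show ?thesis
      using that[of k] by blast
  qed
  have "W i = W k'" if i: "i \<ge> k'" for i
  proof (intro equalityI anti[OF i] subsetI)
    fix p assume p: "p \<in> W k'"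
    have "K i = K k'"
      using k i k'(1) by (metis order_trans)
    show "p \<in> W i"
    proof (cases "W k' \<subseteq> null_on {m}")
      case True
      then show ?thesis
        using p \<open>K i = K k'\<close> k'(2)[OF i] by (auto simp: K_def)
    next
      case False
      then obtain q where q: "q \<in> W i" "Poly_Mapping.lookup q m \<noteq> 0"
        using k'(2)[OF i] by (auto simp: null_on_def)
      \<comment> \<open>A multiple of \<open>q\<close> with the same coordinate at \<open>m\<close>
        as \<open>p\<close>, so that \<open>p - q'\<close> falls into the stable kernel.\<close>
      define q' where "q' = Poly_Mapping.map ((*) (Poly_Mapping.lookup p m / Poly_Mapping.lookup q m)) q"
      have q': "q' \<in> W i" "Poly_Mapping.lookup q' m = Poly_Mapping.lookup p m"
        using q insert.prems(3) by (auto simp: q'_def Poly_Mapping.map.rep_eq when_def)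
      then have "p - q' \<in> K k'"
        using insert.prems(2)[of p k' q'] p anti[OF i] by (auto simp: K_def null_on_def lookup_minus)
      then have "p - q' \<in> W i"
        using \<open>K i = K k'\<close> by (auto simp: K_def)
      \<comment> \<open>Only closure under differences is assumed, so adding \<open>q'\<close> is
        written as subtracting \<open>q' - q' - q'\<close>, that is \<open>- q'\<close>.\<close>
      then have "(p - q') - (q' - q' - q') \<in> W i"
        using q'(1) insert.prems(2) by blast
      then show ?thesis
        by simp
    qed
  qed
  then show ?case by blast
qed

text \<open>A chain of ideals pulls back to a chain of subspaces containing the ideal. These differ
  only in the finitely many coordinates at standard monomials, so the chain of subspaces
  stabilises.\<close>

lemma artinian_quotient:
  assumes fin: "finite (standard n Q)"
  shows "artinian_cring (mpoly_ring n Quot (monomial_ideal n Q :: ((nat \<Rightarrow>\<^sub>0 nat) \<Rightarrow>\<^sub>0 'k::field) set))"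
proof -
  let ?R = "mpoly_ring n :: ((nat \<Rightarrow>\<^sub>0 nat) \<Rightarrow>\<^sub>0 'k) ring"
  let ?I = "monomial_ideal n Q :: ((nat \<Rightarrow>\<^sub>0 nat) \<Rightarrow>\<^sub>0 'k) set"
  let ?A = "?R Quot ?I"
  interpret I: ideal ?I ?R
    by (rule ideal_monomial_ideal)
  interpret h: ring_hom_ring ?R ?A "(+>\<^bsub>?R\<^esub>) ?I"
    by (rule I.rcos_ring_hom_ring)
  have carrier_A: "carrier ?A = (+>\<^bsub>?R\<^esub>) ?I ` carrier ?R"
    by (auto simp: FactRing_def A_RCOSETS_def' )
  show ?thesis
  proof (intro artinian_cring.intro artinian_cring_axioms.intro I.quotient_is_cring mpoly_ring_cring)
    fix J :: "nat \<Rightarrow> ((nat \<Rightarrow>\<^sub>0 nat) \<Rightarrow>\<^sub>0 'k) set set"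
    assume J: "\<And>i. ideal (J i) ?A" and desc: "\<And>i. J (Suc i) \<subseteq> J i"
    define W where "W i = {p \<in> carrier ?R. ?I +>\<^bsub>?R\<^esub> p \<in> J i}" for i
    have W: "ideal (W i) ?R" for i
      unfolding W_def by (rule h.ideal_vimage[OF J])
    \<comment> \<open>The quotient map is onto, so each ideal is recovered from its
      preimage.\<close>
    have JW: "J i = (+>\<^bsub>?R\<^esub>) ?I ` W i" for i
      using additive_subgroup.a_subset[OF ideal.axioms(1)[OF J[of i]]] unfolding carrier_A W_def by auto
    have IW: "?I \<subseteq> W i" for i
    proof
      fix p assume p: "p \<in> ?I"
      then have "?I +>\<^bsub>?R\<^esub> p = ?I +>\<^bsub>?R\<^esub> 0"
        by (subst coset_eq_iff) (auto simp: monomial_ideal_def carrier_mpoly_ring_closed)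
      moreover have "?I +>\<^bsub>?R\<^esub> 0 \<in> J i"
        using h.hom_zero additive_subgroup.zero_closed[OF ideal.axioms(1)[OF J[of i]]] by simp
      ultimately show "p \<in> W i"
        using p by (simp add: W_def monomial_ideal_def)
    qed
    have diff: "p - q \<in> W i" if pq: "p \<in> W i" "q \<in> W i" for i p q
    proof -
      have "q \<in> carrier ?R"
        using pq by (simp add: W_def)
      then have "- q \<in> W i"
        using additive_subgroup.a_inv_closed[OF ideal.axioms(1)[OF W] pq(2)] by (simp add: a_inv_mpoly_ring)
      then show ?thesis
        using additive_subgroup.a_closed[OF ideal.axioms(1)[OF W] pq(1), of "- q"] by simp
    qed
    have scale: "Poly_Mapping.map ((*) c) p \<in> W i" if p: "p \<in> W i" for i p c
    proof -
      have "Poly_Mapping.single 0 c \<in> carrier ?R"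
        by (simp add: carrier_mpoly_ring)
      then show ?thesis
        using ideal.I_l_closed[OF W p, of "Poly_Mapping.single 0 c"] by (simp add: mult_map_scale_conv_mult)
    qed
    \<comment> \<open>Below the finitely many coordinates the chain is constant, which starts the
      stabilisation argument.\<close>
    have null: "W i \<inter> null_on (standard n Q) = ?I" for i
      using IW[of i] by (auto simp: W_def monomial_ideal_def)
    have "W (Suc i) \<subseteq> W i" for i
      using desc[of i] unfolding W_def by blast
    then have "\<exists>k. \<forall>i\<ge>k. W i = W k"
      by (rule descending_chain_null_on[OF fin _ diff scale]) (simp_all add: null)
    then show "\<exists>k. \<forall>i\<ge>k. J i = J k"
      unfolding JW by metis
  qed
qed

theorem corollary2p12:
  fixes n \<mu> :: nat
  assumes "n \<le> \<mu>" and "\<mu> \<le> (n + 1) choose 2"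
  defines "R \<equiv> (mpoly_ring n :: ((nat \<Rightarrow>\<^sub>0 nat) \<Rightarrow>\<^sub>0 'k::field_char_0) ring)"
  shows "\<exists>I. ideal I R \<and> artinian_cring (R Quot I) \<and>
           (\<exists>G \<subseteq> quadratic_monomials n. finite G \<and> card G = \<mu> \<and> minimally_generates R G I) \<and>
           strong_lefschetz (R Quot I) (quotient_part n I)"
proof -
  obtain Q c and l :: "(nat \<Rightarrow>\<^sub>0 nat) \<Rightarrow>\<^sub>0 'k" where Q: "Q \<subseteq> quadratic n"
    and squares: "\<And>i. i < n \<Longrightarrow> Poly_Mapping.single i 2 \<in> Q" and card: "card Q = \<mu>"
    and C: "centred n (standard n Q) l c"
    using exists_centred[OF assms(1,2)] by blast
  let ?G = "(\<lambda>q. Poly_Mapping.single q 1) ` Q :: ((nat \<Rightarrow>\<^sub>0 nat) \<Rightarrow>\<^sub>0 'k) set"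
  have "inj_on (\<lambda>q. Poly_Mapping.single q (1::'k)) Q"
    by (rule inj_onI) (metis keys_single singleton_inject zero_neq_one)
  then have "card ?G = \<mu>"
    using card by (simp add: card_image)
  moreover have "finite ?G"
    using Q quadratic_finite_card finite_subset by blast
  moreover have "?G \<subseteq> quadratic_monomials n"
    using Q by (auto simp: quadratic_monomials_def quadratic_def)
  ultimately show ?thesis
    unfolding R_def using minimally_generates_monomial_ideal[OF Q]
    by (intro exI[of _ "monomial_ideal n Q"] conjI exI[of _ ?G] ideal_monomial_ideal
      artinian_quotient[OF finite_standard[OF squares]] strong_lefschetz_centred[OF C])
qed

end
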